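(* Let $\mathcal{T}$ be a triangulated category. Every map of (exact) triangles in $\mathcal{T}$ whose source triangle or target triangle is contractible is good and Verdier good.
   Context: $\mathcal{T}$ is a triangulated category with self-equivalence $\Sigma$. "Exact triangle" or "triangle" means distinguished triangle. A map of triangles $(f,g,h)$ from $X\xrightarrow{u}Y\xrightarrow{v}Z\xrightarrow{w}\Sigma X$ to $X'\xrightarrow{u'}Y'\xrightarrow{v'}Z'\xrightarrow{w'}\Sigma X'$ consists of $f\colon X\to X'$, $g\colon Y\to Y'$, $h\colon Z\to Z'$ with $gu=u'f$, $hv=v'g$, $(\Sigma f)w=w'h$. It is nullhomotopic if there are maps $F\colon Y\to X'$, $G\colon Z\to Y'$, $H\colon\Sigma X\to Z'$ with $f=Fu+\Sigma^{-1}(w'H)$, $g=Gv+u'F$, $h=Hw+v'G$. A triangle is contractible if its identity map $(1_X,1_Y,1_Z)$ is nullhomotopic. The mapping cone of $(f,g,h)$ is the sequence $X'\oplus Y\to Y'\oplus Z\to Z'\oplus\Sigma X\to\Sigma X'\oplus\Sigma Y$ with successive maps $\begin{bmatrix}u'&g\\0&-v\end{bmatrix},\begin{bmatrix}v'&h\\0&-w\end{bmatrix},\begin{bmatrix}w'&\Sigma f\\0&-\Sigma u\end{bmatrix}$ (acting on column vectors). $(f,g,h)$ is good if its mapping cone is an exact triangle. Octahedra: given composable maps $P\xrightarrow{a}Q\xrightarrow{b}R$ and exact triangles $P\xrightarrow{a}Q\xrightarrow{a'}C_a\xrightarrow{a''}\Sigma P$, $Q\xrightarrow{b}R\xrightarrow{b'}C_b\xrightarrow{b''}\Sigma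 Q$, $P\xrightarrow{ba}R\xrightarrow{c'}C\xrightarrow{c''}\Sigma P$, an octahedron for the composite $ba$ consists of maps $\alpha\colon C_a\to C$, $\beta\colon C\to C_b$, $\gamma\colon C_b\to\Sigma C_a$ such that $C_a\xrightarrow{\alpha}C\xrightarrow{\beta}C_b\xrightarrow{\gamma}\Sigma C_a$ is exact and $\alpha a'=c'b$, $c''\alpha=a''$, $\beta c'=b'$, $\gamma=(\Sigma a')b''$, $b''\beta=(\Sigma a)c''$. Verdier good: choose exact triangles $X\xrightarrow{f}X'\xrightarrow{f'}X''\xrightarrow{f''}\Sigma X$, $Y\xrightarrow{g}Y'\xrightarrow{g'}Y''\xrightarrow{g''}\Sigma Y$ and $X\xrightarrow{gu=u'f}Y'\xrightarrow{\tilde v}A\xrightarrow{\tilde w}\Sigma X$. The map $(f,g,h)$ is Verdier good if there exist an octahedron $(\alpha_1\colon Z\to A,\ \beta_1\colon A\to Y'',\ \gamma_1)$ for the composite $X\xrightarrow{u}Y\xrightarrow{g}Y'$ and an octahedron $(\alpha_2\colon X''\to A,\ \beta_2\colon A\to Z',\ \gamma_2)$ for the composite $X\xrightarrow{f}X'\xrightarrow{u'}Y'$ (both using the given and chosen triangles, in particular the same triangle on $gu=u'f$) such that $h=\beta_2\alpha_1$. This does not depend on the chosen triangles. *)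

theory Defs
  imports "HOL-Algebra.Group"
begin

text \<open>
  A category is given by a set of objects, a set of arrows and the source and target maps; its
  composition is a total function of which only the values on composable arrows matter.  In the
  same way, addition is only relevant on parallel arrows.  A triangle
  \<open>X \<rightarrow> Y \<rightarrow> Z \<rightarrow> \<Sigma>X\<close> is represented by the triple of its three arrows, which determines its objects.
\<close>

record ('o, 'm) tri_data =
  Obj :: "'o set"
  Arr :: "'m set"
  source :: "'m \<Rightarrow> 'o"
  target :: "'m \<Rightarrow> 'o"
  ident :: "'o \<Rightarrow> 'm"  (\<open>\<one>\<^sub>m\<index>\<close>)
  cmp :: "'m \<Rightarrow> 'm \<Rightarrow> 'm"  (infixr \<open>\<cdot>\<index>\<close> 70)
  plus_arr :: "'m \<Rightarrow> 'm \<Rightarrow> 'm"  (infixl \<open>\<^bold>+\<index>\<close> 65)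
  zero_arr :: "'o \<Rightarrow> 'o \<Rightarrow> 'm"  (\<open>\<zero>\<^sub>m\<index>\<close>)
  susp_obj :: "'o \<Rightarrow> 'o"  (\<open>\<Sigma>\<^sub>o\<index>\<close>)
  susp :: "'m \<Rightarrow> 'm"  (\<open>\<Sigma>\<index>\<close>)
  exact :: "('m \<times> 'm \<times> 'm) set"

context
  fixes T :: "('o, 'm) tri_data" (structure)
begin

section \<open>Categories and equivalences\<close>

definition hom :: "'o \<Rightarrow> 'o \<Rightarrow> 'm set" where
  "hom X Y = {f \<in> Arr T. source T f = X \<and> target T f = Y}"

definition iso_arr :: "'m \<Rightarrow> bool" where
  "iso_arr f \<longleftrightarrow> f \<in> Arr T \<and>
     (\<exists>g \<in> hom (target T f) (source T f).
        g \<cdot> f = \<one>\<^sub>m (source T f) \<and> f \<cdot> g = \<one>\<^sub>m (target T f))"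

definition endofunctor :: "('o \<Rightarrow> 'o) \<Rightarrow> ('m \<Rightarrow> 'm) \<Rightarrow> bool" where
  "endofunctor Fo Fm \<longleftrightarrow>
     (\<forall>X \<in> Obj T. Fo X \<in> Obj T \<and> Fm (\<one>\<^sub>m X) = \<one>\<^sub>m (Fo X)) \<and>
     (\<forall>X \<in> Obj T. \<forall>Y \<in> Obj T. \<forall>f \<in> hom X Y. Fm f \<in> hom (Fo X) (Fo Y)) \<and>
     (\<forall>f \<in> Arr T. \<forall>g \<in> Arr T. source T g = target T f \<longrightarrow> Fm (g \<cdot> f) = Fm g \<cdot> Fm f)"

definition natural_iso ::
  "('o \<Rightarrow> 'o) \<Rightarrow> ('m \<Rightarrow> 'm) \<Rightarrow> ('o \<Rightarrow> 'o) \<Rightarrow> ('m \<Rightarrow> 'm) \<Rightarrow> ('o \<Rightarrow> 'm) \<Rightarrow> bool" where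
  "natural_iso Fo Fm Go Gm \<eta> \<longleftrightarrow>
     (\<forall>X \<in> Obj T. \<eta> X \<in> hom (Fo X) (Go X) \<and> iso_arr (\<eta> X)) \<and>
     (\<forall>X \<in> Obj T. \<forall>Y \<in> Obj T. \<forall>f \<in> hom X Y. \<eta> Y \<cdot> Fm f = Gm f \<cdot> \<eta> X)"

definition self_equivalence :: "('o \<Rightarrow> 'o) \<Rightarrow> ('m \<Rightarrow> 'm) \<Rightarrow> bool" where
  "self_equivalence Fo Fm \<longleftrightarrow> endofunctor Fo Fm \<and>
     (\<exists>Go Gm \<eta> \<epsilon>. endofunctor Go Gm \<and>
        natural_iso (\<lambda>X. X) (\<lambda>f. f) (\<lambda>X. Go (Fo X)) (\<lambda>f. Gm (Fm f)) \<eta> \<and>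
        natural_iso (\<lambda>X. Fo (Go X)) (\<lambda>f. Fm (Gm f)) (\<lambda>X. X) (\<lambda>f. f) \<epsilon>)"

section \<open>Additive structure\<close>

definition hom_group :: "'o \<Rightarrow> 'o \<Rightarrow> 'm monoid" where
  "hom_group X Y = \<lparr>carrier = hom X Y, mult = (\<lambda>f g. f \<^bold>+ g), one = \<zero>\<^sub>m X Y\<rparr>"

definition neg_arr :: "'m \<Rightarrow> 'm" where
  "neg_arr f = inv\<^bsub>hom_group (source T f) (target T f)\<^esub> f"

definition zero_object :: "'o \<Rightarrow> bool" where
  "zero_object Z \<longleftrightarrow> Z \<in> Obj T \<and>
     (\<forall>X \<in> Obj T. (\<exists>!f. f \<in> hom X Z) \<and> (\<exists>!f. f \<in> hom Z X))"

definition biproduct :: "'o \<Rightarrow> 'o \<Rightarrow> 'o \<times> 'm \<times> 'm \<times> 'm \<times> 'm \<Rightarrow> bool" where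
  "biproduct A B = (\<lambda>(P, i1, i2, p1, p2).
     P \<in> Obj T \<and> i1 \<in> hom A P \<and> i2 \<in> hom B P \<and> p1 \<in> hom P A \<and> p2 \<in> hom P B \<and>
     p1 \<cdot> i1 = \<one>\<^sub>m A \<and> p2 \<cdot> i2 = \<one>\<^sub>m B \<and> p1 \<cdot> i2 = \<zero>\<^sub>m B A \<and> p2 \<cdot> i1 = \<zero>\<^sub>m A B \<and>
     (i1 \<cdot> p1) \<^bold>+ (i2 \<cdot> p2) = \<one>\<^sub>m P)"

text \<open>
  One choice of biproduct for every pair of objects.  Other choices give isomorphic mapping cones,
  so goodness below does not depend on this.
\<close>

definition bip :: "'o \<Rightarrow> 'o \<Rightarrow> 'o \<times> 'm \<times> 'm \<times> 'm \<times> 'm" where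
  "bip A B = (SOME b. biproduct A B b)"

definition bip_obj :: "'o \<Rightarrow> 'o \<Rightarrow> 'o" where
  "bip_obj A B = (case bip A B of (P, i1, i2, p1, p2) \<Rightarrow> P)"

definition inj1 :: "'o \<Rightarrow> 'o \<Rightarrow> 'm" where
  "inj1 A B = (case bip A B of (P, i1, i2, p1, p2) \<Rightarrow> i1)"

definition inj2 :: "'o \<Rightarrow> 'o \<Rightarrow> 'm" where
  "inj2 A B = (case bip A B of (P, i1, i2, p1, p2) \<Rightarrow> i2)"

definition proj1 :: "'o \<Rightarrow> 'o \<Rightarrow> 'm" where
  "proj1 A B = (case bip A B of (P, i1, i2, p1, p2) \<Rightarrow> p1)"

definition proj2 :: "'o \<Rightarrow> 'o \<Rightarrow> 'm" where
  "proj2 A B = (case bip A B of (P, i1, i2, p1, p2) \<Rightarrow> p2)"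

text \<open>The arrow \<open>A \<oplus> B \<rightarrow> C \<oplus> D\<close> given by the matrix with rows \<open>(a, b)\<close> and \<open>(c, d)\<close>.\<close>

definition matrix_arr :: "'o \<Rightarrow> 'o \<Rightarrow> 'o \<Rightarrow> 'o \<Rightarrow> 'm \<Rightarrow> 'm \<Rightarrow> 'm \<Rightarrow> 'm \<Rightarrow> 'm" where
  "matrix_arr A B C D a b c d =
     (inj1 C D \<cdot> a \<cdot> proj1 A B) \<^bold>+ (inj1 C D \<cdot> b \<cdot> proj2 A B) \<^bold>+
     (inj2 C D \<cdot> c \<cdot> proj1 A B) \<^bold>+ (inj2 C D \<cdot> d \<cdot> proj2 A B)"

text \<open>The canonical isomorphism \<open>\<Sigma>A \<oplus> \<Sigma>B \<rightarrow> \<Sigma>(A \<oplus> B)\<close>.\<close>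

definition susp_bip :: "'o \<Rightarrow> 'o \<Rightarrow> 'm" where
  "susp_bip A B =
     (\<Sigma> (inj1 A B) \<cdot> proj1 (\<Sigma>\<^sub>o A) (\<Sigma>\<^sub>o B)) \<^bold>+ (\<Sigma> (inj2 A B) \<cdot> proj2 (\<Sigma>\<^sub>o A) (\<Sigma>\<^sub>o B))"

section \<open>Triangles\<close>

fun candidate_triangle :: "'m \<times> 'm \<times> 'm \<Rightarrow> bool" where
  "candidate_triangle (u, v, w) \<longleftrightarrow> u \<in> Arr T \<and> v \<in> Arr T \<and> w \<in> Arr T \<and>
     source T v = target T u \<and> source T w = target T v \<and> target T w = \<Sigma>\<^sub>o (source T u)"

fun triangle_map :: "'m \<times> 'm \<times> 'm \<Rightarrow> 'm \<times> 'm \<times> 'm \<Rightarrow> 'm \<times> 'm \<times> 'm \<Rightarrow> bool" where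
  "triangle_map (u, v, w) (u', v', w') (f, g, h) \<longleftrightarrow>
     f \<in> hom (source T u) (source T u') \<and>
     g \<in> hom (source T v) (source T v') \<and>
     h \<in> hom (source T w) (source T w') \<and>
     g \<cdot> u = u' \<cdot> f \<and> h \<cdot> v = v' \<cdot> g \<and> \<Sigma> f \<cdot> w = w' \<cdot> h"

text \<open>
  \<open>octahedron (a, a', a'') (b, b', b'') (c, c', c'') (\<alpha>, \<beta>, \<gamma>)\<close> is meant for \<open>c = b \<cdot> a\<close> and for
  exact triangles on \<open>a\<close>, \<open>b\<close> and \<open>c\<close>, whose cones are the targets of \<open>a'\<close>, \<open>b'\<close> and \<open>c'\<close>.
\<close>

fun octahedron ::
  "'m \<times> 'm \<times> 'm \<Rightarrow> 'm \<times> 'm \<times> 'm \<Rightarrow> 'm \<times> 'm \<times> 'm \<Rightarrow> 'm \<times> 'm \<times> 'm \<Rightarrow> bool" where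
  "octahedron (a, a', a'') (b, b', b'') (c, c', c'') (\<alpha>, \<beta>, \<gamma>) \<longleftrightarrow>
     \<alpha> \<in> hom (target T a') (target T c') \<and>
     \<beta> \<in> hom (target T c') (target T b') \<and>
     \<gamma> \<in> hom (target T b') (\<Sigma>\<^sub>o (target T a')) \<and>
     (\<alpha>, \<beta>, \<gamma>) \<in> exact T \<and>
     \<alpha> \<cdot> a' = c' \<cdot> b \<and> c'' \<cdot> \<alpha> = a'' \<and> \<beta> \<cdot> c' = b' \<and> \<gamma> = \<Sigma> a' \<cdot> b'' \<and>
     b'' \<cdot> \<beta> = \<Sigma> a \<cdot> c''"

end

section \<open>Triangulated categories\<close>

locale category =
  fixes T :: "('o, 'm) tri_data" (structure)
  assumes source_in_Obj: "f \<in> Arr T \<Longrightarrow> source T f \<in> Obj T"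
    and target_in_Obj: "f \<in> Arr T \<Longrightarrow> target T f \<in> Obj T"
    and ident_in_hom: "X \<in> Obj T \<Longrightarrow> \<one>\<^sub>m X \<in> hom T X X"
    and cmp_in_hom: "f \<in> hom T X Y \<Longrightarrow> g \<in> hom T Y Z \<Longrightarrow> g \<cdot> f \<in> hom T X Z"
    and cmp_ident_left: "f \<in> hom T X Y \<Longrightarrow> \<one>\<^sub>m Y \<cdot> f = f"
    and cmp_ident_right: "f \<in> hom T X Y \<Longrightarrow> f \<cdot> \<one>\<^sub>m X = f"
    and cmp_assoc:
      "f \<in> hom T W X \<Longrightarrow> g \<in> hom T X Y \<Longrightarrow> h \<in> hom T Y Z \<Longrightarrow> (h \<cdot> g) \<cdot> f = h \<cdot> (g \<cdot> f)"

locale additive_category = category +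
  assumes hom_comm_group: "X \<in> Obj T \<Longrightarrow> Y \<in> Obj T \<Longrightarrow> comm_group (hom_group T X Y)"
    and cmp_plus_left:
      "f \<in> hom T X Y \<Longrightarrow> g \<in> hom T Y Z \<Longrightarrow> g' \<in> hom T Y Z \<Longrightarrow>
       (g \<^bold>+ g') \<cdot> f = (g \<cdot> f) \<^bold>+ (g' \<cdot> f)"
    and cmp_plus_right:
      "f \<in> hom T X Y \<Longrightarrow> f' \<in> hom T X Y \<Longrightarrow> g \<in> hom T Y Z \<Longrightarrow>
       g \<cdot> (f \<^bold>+ f') = (g \<cdot> f) \<^bold>+ (g \<cdot> f')"
    and zero_object_exists: "\<exists>Z. zero_object T Z"
    and biproduct_exists: "A \<in> Obj T \<Longrightarrow> B \<in> Obj T \<Longrightarrow> \<exists>b. biproduct T A B b"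

locale triangulated_category = additive_category +
  assumes susp_equivalence: "self_equivalence T (susp_obj T) (susp T)"
    and susp_plus: "f \<in> hom T X Y \<Longrightarrow> g \<in> hom T X Y \<Longrightarrow> \<Sigma> (f \<^bold>+ g) = \<Sigma> f \<^bold>+ \<Sigma> g"
    and exact_candidate: "t \<in> exact T \<Longrightarrow> candidate_triangle T t"
    and exact_iso:
      "t \<in> exact T \<Longrightarrow> candidate_triangle T t' \<Longrightarrow> triangle_map T t t' (f, g, h) \<Longrightarrow>
       iso_arr T f \<Longrightarrow> iso_arr T g \<Longrightarrow> iso_arr T h \<Longrightarrow> t' \<in> exact T"
    and exact_ident:
      "X \<in> Obj T \<Longrightarrow> zero_object T Z \<Longrightarrow> (\<one>\<^sub>m X, \<zero>\<^sub>m X Z, \<zero>\<^sub>m Z (\<Sigma>\<^sub>o X)) \<in> exact T"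
    and exact_completion: "u \<in> Arr T \<Longrightarrow> \<exists>v w. (u, v, w) \<in> exact T"
    and exact_rotate:
      "candidate_triangle T (u, v, w) \<Longrightarrow>
       (u, v, w) \<in> exact T \<longleftrightarrow> (v, w, neg_arr T (\<Sigma> u)) \<in> exact T"
    and exact_fill:
      "(u, v, w) \<in> exact T \<Longrightarrow> (u', v', w') \<in> exact T \<Longrightarrow>
       f \<in> hom T (source T u) (source T u') \<Longrightarrow> g \<in> hom T (target T u) (target T u') \<Longrightarrow>
       g \<cdot> u = u' \<cdot> f \<Longrightarrow> \<exists>h. triangle_map T (u, v, w) (u', v', w') (f, g, h)"
    and exact_octahedron:
      "(a, a', a'') \<in> exact T \<Longrightarrow> (b, b', b'') \<in> exact T \<Longrightarrow> source T b = target T a \<Longrightarrow>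
       (b \<cdot> a, c', c'') \<in> exact T \<Longrightarrow>
       \<exists>\<alpha> \<beta> \<gamma>. octahedron T (a, a', a'') (b, b', b'') (b \<cdot> a, c', c'') (\<alpha>, \<beta>, \<gamma>)"

section \<open>Contractible triangles and good maps\<close>

context
  fixes T :: "('o, 'm) tri_data" (structure)
begin

text \<open>
  Since \<open>\<Sigma>\<close> is only an equivalence, \<open>\<Sigma>\<^sup>-\<^sup>1 k\<close> for an arrow \<open>k : \<Sigma>X \<rightarrow> \<Sigma>Y\<close> is read as the unique
  arrow \<open>X \<rightarrow> Y\<close> with suspension \<open>k\<close>; see \<open>desusp_unique\<close> below.
\<close>

definition desusp :: "'o \<Rightarrow> 'o \<Rightarrow> 'm \<Rightarrow> 'm" where
  "desusp X Y k = (THE f. f \<in> hom T X Y \<and> \<Sigma> f = k)"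

fun nullhomotopic :: "'m \<times> 'm \<times> 'm \<Rightarrow> 'm \<times> 'm \<times> 'm \<Rightarrow> 'm \<times> 'm \<times> 'm \<Rightarrow> bool" where
  "nullhomotopic (u, v, w) (u', v', w') (f, g, h) \<longleftrightarrow>
     (\<exists>F \<in> hom T (source T v) (source T u').
      \<exists>G \<in> hom T (source T w) (source T v').
      \<exists>H \<in> hom T (\<Sigma>\<^sub>o (source T u)) (source T w').
        f = (F \<cdot> u) \<^bold>+ desusp (source T u) (source T u') (w' \<cdot> H) \<and>
        g = (G \<cdot> v) \<^bold>+ (u' \<cdot> F) \<and>
        h = (H \<cdot> w) \<^bold>+ (v' \<cdot> G))"

fun contractible :: "'m \<times> 'm \<times> 'm \<Rightarrow> bool" where
  "contractible (u, v, w) \<longleftrightarrow>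
     nullhomotopic (u, v, w) (u, v, w) (\<one>\<^sub>m (source T u), \<one>\<^sub>m (source T v), \<one>\<^sub>m (source T w))"

text \<open>
  The last arrow is composed with \<open>susp_bip\<close> so that it ends in \<open>\<Sigma>(X' \<oplus> Y)\<close>, which in general
  is only isomorphic to \<open>\<Sigma>X' \<oplus> \<Sigma>Y\<close>.
\<close>

fun mapping_cone ::
  "'m \<times> 'm \<times> 'm \<Rightarrow> 'm \<times> 'm \<times> 'm \<Rightarrow> 'm \<times> 'm \<times> 'm \<Rightarrow> 'm \<times> 'm \<times> 'm" where
  "mapping_cone (u, v, w) (u', v', w') (f, g, h) =
     (let X = source T u; Y = source T v; Z = source T w;
          X' = source T u'; Y' = source T v'; Z' = source T w'
      in (matrix_arr T X' Y Y' Z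
            u' g
            (\<zero>\<^sub>m X' Z) (neg_arr T v),
          matrix_arr T Y' Z Z' (\<Sigma>\<^sub>o X)
            v' h
            (\<zero>\<^sub>m Y' (\<Sigma>\<^sub>o X)) (neg_arr T w),
          susp_bip T X' Y \<cdot>
          matrix_arr T Z' (\<Sigma>\<^sub>o X) (\<Sigma>\<^sub>o X') (\<Sigma>\<^sub>o Y)
            w' (\<Sigma> f)
            (\<zero>\<^sub>m Z' (\<Sigma>\<^sub>o Y)) (neg_arr T (\<Sigma> u))))"

definition good :: "'m \<times> 'm \<times> 'm \<Rightarrow> 'm \<times> 'm \<times> 'm \<Rightarrow> 'm \<times> 'm \<times> 'm \<Rightarrow> bool" where
  "good t t' \<phi> \<longleftrightarrow> mapping_cone t t' \<phi> \<in> exact T"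

text \<open>
  The condition does not depend on the auxiliary exact triangles on \<open>f\<close>, \<open>g\<close> and \<open>g \<cdot> u = u' \<cdot> f\<close>;
  it is required for every choice of them (such triangles always exist).
\<close>

fun Verdier_good :: "'m \<times> 'm \<times> 'm \<Rightarrow> 'm \<times> 'm \<times> 'm \<Rightarrow> 'm \<times> 'm \<times> 'm \<Rightarrow> bool" where
  "Verdier_good (u, v, w) (u', v', w') (f, g, h) \<longleftrightarrow>
     (\<forall>f' f'' g' g'' v\<^sub>A w\<^sub>A.
        (f, f', f'') \<in> exact T \<and> (g, g', g'') \<in> exact T \<and> (g \<cdot> u, v\<^sub>A, w\<^sub>A) \<in> exact T \<longrightarrow>
        (\<exists>\<alpha>\<^sub>1 \<beta>\<^sub>1 \<gamma>\<^sub>1 \<alpha>\<^sub>2 \<beta>\<^sub>2 \<gamma>\<^sub>2.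
           octahedron T (u, v, w) (g, g', g'') (g \<cdot> u, v\<^sub>A, w\<^sub>A) (\<alpha>\<^sub>1, \<beta>\<^sub>1, \<gamma>\<^sub>1) \<and>
           octahedron T (f, f', f'') (u', v', w') (u' \<cdot> f, v\<^sub>A, w\<^sub>A) (\<alpha>\<^sub>2, \<beta>\<^sub>2, \<gamma>\<^sub>2) \<and>
           h = \<beta>\<^sub>2 \<cdot> \<alpha>\<^sub>1))"

end

lemma (in category) natural_iso_cancel:
  assumes "natural_iso T Fo Fm Go Gm \<eta>" "X \<in> Obj T" "Y \<in> Obj T"
    and "p \<in> hom T (Go X) Y" "q \<in> hom T (Go X) Y" "p \<cdot> \<eta> X = q \<cdot> \<eta> X"
  shows "p = q"
proof -
  have \<eta>: "\<eta> X \<in> hom T (Fo X) (Go X)" "iso_arr T (\<eta> X)"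
    using assms by (auto simp: natural_iso_def)
  then obtain k where k: "k \<in> hom T (Go X) (Fo X)" "\<eta> X \<cdot> k = \<one>\<^sub>m (Go X)"
    by (auto simp: iso_arr_def hom_def)
  have "p = (p \<cdot> \<eta> X) \<cdot> k" "q = (q \<cdot> \<eta> X) \<cdot> k"
    using cmp_assoc[OF k(1) \<eta>(1) assms(4)] cmp_assoc[OF k(1) \<eta>(1) assms(5)] k(2)
      cmp_ident_right assms(4,5) by metis+
  then show ?thesis using assms(6) by simp
qed

lemma (in category) natural_iso_cancel_left:
  assumes "natural_iso T Fo Fm Go Gm \<eta>" "X \<in> Obj T"
    and "p \<in> hom T Y (Fo X)" "q \<in> hom T Y (Fo X)" "\<eta> X \<cdot> p = \<eta> X \<cdot> q"
  shows "p = q"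
proof -
  have \<eta>: "\<eta> X \<in> hom T (Fo X) (Go X)" "iso_arr T (\<eta> X)"
    using assms by (auto simp: natural_iso_def)
  then obtain k where k: "k \<in> hom T (Go X) (Fo X)" "k \<cdot> \<eta> X = \<one>\<^sub>m (Fo X)"
    by (auto simp: iso_arr_def hom_def)
  have "p = k \<cdot> (\<eta> X \<cdot> p)" "q = k \<cdot> (\<eta> X \<cdot> q)"
    using cmp_assoc[OF assms(3) \<eta>(1) k(1)] cmp_assoc[OF assms(4) \<eta>(1) k(1)] k(2)
      cmp_ident_left assms(3,4) by metis+
  then show ?thesis using assms(5) by simp
qed

lemma (in triangulated_category) desusp_unique:
  assumes X: "X \<in> Obj T" and Y: "Y \<in> Obj T" and k: "k \<in> hom T (\<Sigma>\<^sub>o X) (\<Sigma>\<^sub>o Y)"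
  shows "\<exists>!f. f \<in> hom T X Y \<and> \<Sigma> f = k"
proof -
  obtain Go Gm \<eta> \<epsilon> where S: "endofunctor T (susp_obj T) (susp T)" and G: "endofunctor T Go Gm"
    and \<eta>: "natural_iso T (\<lambda>X. X) (\<lambda>f. f) (\<lambda>X. Go (\<Sigma>\<^sub>o X)) (\<lambda>f. Gm (\<Sigma> f)) \<eta>"
    and \<epsilon>: "natural_iso T (\<lambda>X. \<Sigma>\<^sub>o (Go X)) (\<lambda>f. \<Sigma> (Gm f)) (\<lambda>X. X) (\<lambda>f. f) \<epsilon>"
    using susp_equivalence unfolding self_equivalence_def by auto
  have SX: "\<Sigma>\<^sub>o X \<in> Obj T" and SY: "\<Sigma>\<^sub>o Y \<in> Obj T"
    using S X Y by (auto simp: endofunctor_def)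
  have G_faithful: "p = q"
    if "p \<in> hom T (\<Sigma>\<^sub>o X) (\<Sigma>\<^sub>o Y)" "q \<in> hom T (\<Sigma>\<^sub>o X) (\<Sigma>\<^sub>o Y)" "Gm p = Gm q" for p q
  proof -
    have "\<epsilon> (\<Sigma>\<^sub>o Y) \<cdot> \<Sigma> (Gm r) = r \<cdot> \<epsilon> (\<Sigma>\<^sub>o X)" if "r \<in> hom T (\<Sigma>\<^sub>o X) (\<Sigma>\<^sub>o Y)" for r
      using \<epsilon> that SX SY by (auto simp: natural_iso_def)
    then have "p \<cdot> \<epsilon> (\<Sigma>\<^sub>o X) = q \<cdot> \<epsilon> (\<Sigma>\<^sub>o X)" using that by metis
    then show ?thesis using natural_iso_cancel[OF \<epsilon> SX SY] that by blast
  qed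
  have nat: "\<eta> Y \<cdot> f = Gm (\<Sigma> f) \<cdot> \<eta> X" if "f \<in> hom T X Y" for f
    using \<eta> that X Y by (auto simp: natural_iso_def)
  have \<eta>X: "\<eta> X \<in> hom T X (Go (\<Sigma>\<^sub>o X))" and \<eta>Y: "\<eta> Y \<in> hom T Y (Go (\<Sigma>\<^sub>o Y))" "iso_arr T (\<eta> Y)"
    using \<eta> X Y by (auto simp: natural_iso_def)
  obtain j where j: "j \<in> hom T (Go (\<Sigma>\<^sub>o Y)) Y" "\<eta> Y \<cdot> j = \<one>\<^sub>m (Go (\<Sigma>\<^sub>o Y))"
    using \<eta>Y by (auto simp: iso_arr_def hom_def)
  have Gk: "Gm k \<in> hom T (Go (\<Sigma>\<^sub>o X)) (Go (\<Sigma>\<^sub>o Y))"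
    using G k SX SY by (auto simp: endofunctor_def)
  define f where "f = j \<cdot> (Gm k \<cdot> \<eta> X)"
  have Gk\<eta>: "Gm k \<cdot> \<eta> X \<in> hom T X (Go (\<Sigma>\<^sub>o Y))" using cmp_in_hom \<eta>X Gk by blast
  have f: "f \<in> hom T X Y" unfolding f_def using cmp_in_hom Gk\<eta> j(1) by blast
  have Sf: "\<Sigma> f \<in> hom T (\<Sigma>\<^sub>o X) (\<Sigma>\<^sub>o Y)" using S f X Y by (auto simp: endofunctor_def)
  have GSf: "Gm (\<Sigma> f) \<in> hom T (Go (\<Sigma>\<^sub>o X)) (Go (\<Sigma>\<^sub>o Y))"
    using G Sf SX SY by (auto simp: endofunctor_def)
  have "\<eta> Y \<cdot> f = Gm k \<cdot> \<eta> X"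
    unfolding f_def using cmp_assoc[OF Gk\<eta> j(1) \<eta>Y(1)] j(2) cmp_ident_left[OF Gk\<eta>] by simp
  then have e: "Gm (\<Sigma> f) \<cdot> \<eta> X = Gm k \<cdot> \<eta> X" using nat[OF f] by simp
  have "Go (\<Sigma>\<^sub>o Y) \<in> Obj T" using G SY by (auto simp: endofunctor_def)
  then have "Gm (\<Sigma> f) = Gm k" using natural_iso_cancel[OF \<eta> X _ GSf Gk e] by simp
  then have "\<Sigma> f = k" using G_faithful Sf k by blast
  moreover have "p = q" if "p \<in> hom T X Y" "q \<in> hom T X Y" "\<Sigma> p = k" "\<Sigma> q = k" for p q
    using natural_iso_cancel_left[OF \<eta> Y that(1,2)] nat that by metis
  ultimately show ?thesis using f by blast
qed

end

theory Submission
  imports Defs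
begin

text \<open>
  If source or target is contractible, composing the map with the contracting homotopy shows that it
  is nullhomotopic.  The homotopy \<open>(F, G, H)\<close> gives automorphisms \<open>(1, F; 0, 1)\<close>, \<open>(1, G; 0, 1)\<close>,
  \<open>(1, H; 0, 1)\<close> that carry the mapping cone to that of the zero map, which is a direct sum of exact
  triangles.

  For Verdier goodness take arbitrary octahedra, and let \<open>d = h - \<beta>\<^sub>2\<alpha>\<^sub>1\<close>.  Then \<open>dv = 0\<close> and \<open>w'd = 0\<close>,
  so contractibility yields \<open>k : \<Sigma>X \<rightarrow> Y'\<close> with \<open>d = v'kw\<close>.  Moving the first octahedron by the
  automorphism \<open>1 + v\<^sub>A k w\<^sub>A\<close> of \<open>A\<close> changes \<open>\<beta>\<^sub>2\<alpha>\<^sub>1\<close> by \<open>\<beta>\<^sub>2 v\<^sub>A k w\<^sub>A \<alpha>\<^sub>1 = v'kw\<close>, that is, to \<open>h\<close>.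
\<close>

section \<open>Arrow calculus\<close>

context category
begin

lemma hom_iff: "f \<in> hom T X Y \<longleftrightarrow> f \<in> Arr T \<and> source T f = X \<and> target T f = Y"
  by (auto simp: hom_def)

lemma hom_Obj:
  assumes "f \<in> hom T X Y"
  shows "X \<in> Obj T" "Y \<in> Obj T"
  using assms source_in_Obj target_in_Obj by (auto simp: hom_iff)

lemma cmp_Arr [simp]:
  assumes "f \<in> Arr T" "g \<in> Arr T" "source T g = target T f"
  shows "g \<cdot> f \<in> Arr T" "source T (g \<cdot> f) = source T f" "target T (g \<cdot> f) = target T g"
  using cmp_in_hom[of f "source T f" "target T f" g "target T g"] assms by (auto simp: hom_iff)

lemma ident_Arr [simp]:
  assumes "X \<in> Obj T"
  shows "\<one>\<^sub>m X \<in> Arr T" "source T (\<one>\<^sub>m X) = X" "target T (\<one>\<^sub>m X) = X"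
  using ident_in_hom[OF assms] by (auto simp: hom_iff)

lemma ident_cmp [simp]: "f \<in> Arr T \<Longrightarrow> target T f = Y \<Longrightarrow> \<one>\<^sub>m Y \<cdot> f = f"
  using cmp_ident_left by (auto simp: hom_iff)

lemma cmp_ident [simp]: "f \<in> Arr T \<Longrightarrow> source T f = X \<Longrightarrow> f \<cdot> \<one>\<^sub>m X = f"
  using cmp_ident_right by (auto simp: hom_iff)

lemma assoc [simp]:
  "\<lbrakk>f \<in> Arr T; g \<in> Arr T; h \<in> Arr T; source T g = target T f; source T h = target T g\<rbrakk>
   \<Longrightarrow> (h \<cdot> g) \<cdot> f = h \<cdot> (g \<cdot> f)"
  using cmp_assoc by (auto simp: hom_iff)

text \<open>\<open>simp\<close> brackets composites to the right, so the left side of an equation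
  \<open>g \<cdot> f = k\<close> is no longer a subterm once a further arrow is composed on the
  right. The equation is the first premise so that \<open>THEN cmp_reassoc\<close> yields the
  rewrite rule for that case.\<close>

lemma cmp_reassoc:
  assumes "g \<cdot> f = k" "f \<in> Arr T" "g \<in> Arr T" "source T g = target T f"
    "x \<in> Arr T" "target T x = source T f"
  shows "g \<cdot> (f \<cdot> x) = k \<cdot> x"
  using assms assoc[of x f g] by simp

lemma iso_arr_ident: "X \<in> Obj T \<Longrightarrow> iso_arr T (\<one>\<^sub>m X)"
  by (auto simp: iso_arr_def hom_iff intro!: bexI[of _ "\<one>\<^sub>m X"])

lemma iso_arrI:
  assumes "f \<in> hom T X Y" "g \<in> hom T Y X" "g \<cdot> f = \<one>\<^sub>m X" "f \<cdot> g = \<one>\<^sub>m Y"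
  shows "iso_arr T f"
  using assms by (auto simp: iso_arr_def hom_iff)

end

context additive_category
begin

section \<open>Abelian group laws for parallel arrows\<close>

lemma zero_Arr [simp]:
  assumes "X \<in> Obj T" "Y \<in> Obj T"
  shows "\<zero>\<^sub>m X Y \<in> Arr T" "source T (\<zero>\<^sub>m X Y) = X" "target T (\<zero>\<^sub>m X Y) = Y"
proof -
  interpret comm_group "hom_group T X Y" using hom_comm_group assms .
  show "\<zero>\<^sub>m X Y \<in> Arr T" "source T (\<zero>\<^sub>m X Y) = X" "target T (\<zero>\<^sub>m X Y) = Y"
    using one_closed by (auto simp: hom_group_def hom_iff)
qed

lemma plus_Arr [simp]:
  assumes "f \<in> Arr T" "g \<in> Arr T" "source T g = source T f" "target T g = target T f"
  shows "f \<^bold>+ g \<in> Arr T" "source T (f \<^bold>+ g) = source T f" "target T (f \<^bold>+ g) = target T f"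
proof -
  interpret comm_group "hom_group T (source T f) (target T f)"
    using hom_comm_group assms source_in_Obj target_in_Obj by blast
  show "f \<^bold>+ g \<in> Arr T" "source T (f \<^bold>+ g) = source T f" "target T (f \<^bold>+ g) = target T f"
    using m_closed[of f g] assms by (auto simp: hom_group_def hom_iff)
qed

lemma neg_Arr [simp]:
  assumes "f \<in> Arr T"
  shows "neg_arr T f \<in> Arr T" "source T (neg_arr T f) = source T f"
    "target T (neg_arr T f) = target T f"
proof -
  interpret comm_group "hom_group T (source T f) (target T f)"
    using hom_comm_group assms source_in_Obj target_in_Obj by blast
  show "neg_arr T f \<in> Arr T" "source T (neg_arr T f) = source T f"
    "target T (neg_arr T f) = target T f"
    using inv_closed[of f] assms by (auto simp: neg_arr_def hom_group_def hom_iff)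
qed

lemma plus_assoc:
  assumes "f \<in> Arr T" "g \<in> Arr T" "h \<in> Arr T" "source T g = source T f" "target T g = target T f"
    "source T h = source T f" "target T h = target T f"
  shows "(f \<^bold>+ g) \<^bold>+ h = f \<^bold>+ (g \<^bold>+ h)"
proof -
  interpret comm_group "hom_group T (source T f) (target T f)"
    using hom_comm_group assms source_in_Obj target_in_Obj by blast
  show ?thesis using m_assoc[of f g h] assms by (auto simp: hom_group_def hom_iff)
qed

lemma plus_comm:
  assumes "f \<in> Arr T" "g \<in> Arr T" "source T g = source T f" "target T g = target T f"
  shows "f \<^bold>+ g = g \<^bold>+ f"
proof -
  interpret comm_group "hom_group T (source T f) (target T f)"
    using hom_comm_group assms source_in_Obj target_in_Obj by blast
  show ?thesis using m_comm[of f g] assms by (auto simp: hom_group_def hom_iff)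
qed

lemma plus_left_comm:
  assumes "f \<in> Arr T" "g \<in> Arr T" "h \<in> Arr T" "source T g = source T f" "target T g = target T f"
    "source T h = source T f" "target T h = target T f"
  shows "f \<^bold>+ (g \<^bold>+ h) = g \<^bold>+ (f \<^bold>+ h)"
  using assms plus_assoc[of f g h] plus_assoc[of g f h] plus_comm[of f g] by simp

lemmas plus_ac = plus_assoc plus_comm plus_left_comm

lemma zero_plus [simp]:
  assumes "f \<in> Arr T" "source T f = X" "target T f = Y"
  shows "\<zero>\<^sub>m X Y \<^bold>+ f = f" "f \<^bold>+ \<zero>\<^sub>m X Y = f"
proof -
  interpret comm_group "hom_group T X Y"
    using hom_comm_group assms source_in_Obj target_in_Obj by blast
  show "\<zero>\<^sub>m X Y \<^bold>+ f = f" "f \<^bold>+ \<zero>\<^sub>m X Y = f"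
    using l_one[of f] r_one[of f] assms by (auto simp: hom_group_def hom_iff)
qed

lemma plus_neg [simp]:
  assumes "f \<in> Arr T"
  shows "f \<^bold>+ neg_arr T f = \<zero>\<^sub>m (source T f) (target T f)"
    "neg_arr T f \<^bold>+ f = \<zero>\<^sub>m (source T f) (target T f)"
proof -
  interpret comm_group "hom_group T (source T f) (target T f)"
    using hom_comm_group assms source_in_Obj target_in_Obj by blast
  show "f \<^bold>+ neg_arr T f = \<zero>\<^sub>m (source T f) (target T f)"
    "neg_arr T f \<^bold>+ f = \<zero>\<^sub>m (source T f) (target T f)"
    using r_inv[of f] l_inv[of f] assms by (auto simp: neg_arr_def hom_group_def hom_iff)
qed

lemma plus_neg_assoc [simp]:
  assumes "f \<in> Arr T" "g \<in> Arr T" "source T g = source T f" "target T g = target T f"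
  shows "f \<^bold>+ (neg_arr T f \<^bold>+ g) = g" "neg_arr T f \<^bold>+ (f \<^bold>+ g) = g"
  using plus_assoc[of f "neg_arr T f" g] plus_assoc[of "neg_arr T f" f g] assms by simp_all

text \<open>After sorting with \<open>plus_ac\<close>, a summand and its negative can remain
  separated by one other term; this rule cancels such a pair.\<close>

lemma plus_plus_neg:
  assumes "f \<in> Arr T" "g \<in> Arr T" "h \<in> Arr T" "source T g = source T f" "target T g = target T f"
    "source T h = source T f" "target T h = target T f"
  shows "f \<^bold>+ (g \<^bold>+ (neg_arr T f \<^bold>+ h)) = g \<^bold>+ h"
  using assms plus_left_comm[of f g "neg_arr T f \<^bold>+ h"] by simp

lemma neg_unique:
  assumes "f \<in> Arr T" "g \<in> Arr T" "source T g = source T f" "target T g = target T f"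
    and "f \<^bold>+ g = \<zero>\<^sub>m (source T f) (target T f)"
  shows "g = neg_arr T f"
  using plus_neg_assoc(2)[of f g] assms by simp

lemma neg_neg [simp]: "f \<in> Arr T \<Longrightarrow> neg_arr T (neg_arr T f) = f"
  using neg_unique[of "neg_arr T f" f] by simp

text \<open>This is how composition and suspension are shown to preserve zero arrows: the image x of
  0 + 0 = 0 under an additive operation satisfies x + x = x.\<close>

lemma plus_eq_self:
  assumes "f \<in> Arr T" "g \<in> Arr T" "source T g = source T f" "target T g = target T f" "f \<^bold>+ g = f"
  shows "g = \<zero>\<^sub>m (source T f) (target T f)"
  using plus_neg_assoc(2)[of f g] assms by simp

lemma eq_if_diff_zero:
  assumes "f \<in> Arr T" "g \<in> Arr T" "source T g = source T f" "target T g = target T f"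
    and "f \<^bold>+ neg_arr T g = \<zero>\<^sub>m (source T f) (target T f)"
  shows "f = g"
proof -
  have "(f \<^bold>+ neg_arr T g) \<^bold>+ g = f" using assms(1-4) by (simp add: plus_assoc)
  then show ?thesis using assms by simp
qed

lemma neg_zero [simp]: "X \<in> Obj T \<Longrightarrow> Y \<in> Obj T \<Longrightarrow> neg_arr T (\<zero>\<^sub>m X Y) = \<zero>\<^sub>m X Y"
  using neg_unique[of "\<zero>\<^sub>m X Y" "\<zero>\<^sub>m X Y"] by simp

lemma neg_plus [simp]:
  assumes "f \<in> Arr T" "g \<in> Arr T" "source T g = source T f" "target T g = target T f"
  shows "neg_arr T (f \<^bold>+ g) = neg_arr T f \<^bold>+ neg_arr T g"
  using assms by (intro neg_unique[symmetric]) (simp_all add: plus_assoc plus_left_comm[of g])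

lemma cmp_plus [simp]:
  assumes "f \<in> Arr T" "g \<in> Arr T" "g' \<in> Arr T" "source T g' = source T g" "target T g' = target T g"
  shows "source T g = target T f \<Longrightarrow> (g \<^bold>+ g') \<cdot> f = (g \<cdot> f) \<^bold>+ (g' \<cdot> f)"
    "source T f = target T g \<Longrightarrow> f \<cdot> (g \<^bold>+ g') = (f \<cdot> g) \<^bold>+ (f \<cdot> g')"
  using assms cmp_plus_left[of f "source T f" "source T g" g "target T g" g']
    cmp_plus_right[of g "source T g" "target T g" g' f "target T f"]
  by (auto simp: hom_iff)

lemma cmp_zero [simp]:
  assumes "f \<in> Arr T"
  shows "X = target T f \<Longrightarrow> Y \<in> Obj T \<Longrightarrow> \<zero>\<^sub>m X Y \<cdot> f = \<zero>\<^sub>m (source T f) Y"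
    "Y = source T f \<Longrightarrow> X \<in> Obj T \<Longrightarrow> f \<cdot> \<zero>\<^sub>m X Y = \<zero>\<^sub>m X (target T f)"
proof -
  have O: "source T f \<in> Obj T" "target T f \<in> Obj T" using assms source_in_Obj target_in_Obj by auto
  show "\<zero>\<^sub>m X Y \<cdot> f = \<zero>\<^sub>m (source T f) Y" if "X = target T f" "Y \<in> Obj T"
  proof -
    have "(\<zero>\<^sub>m X Y \<cdot> f) \<^bold>+ (\<zero>\<^sub>m X Y \<cdot> f) = (\<zero>\<^sub>m X Y \<^bold>+ \<zero>\<^sub>m X Y) \<cdot> f"
      by (rule cmp_plus(1)[symmetric]) (simp_all add: assms O that)
    then show ?thesis
      using plus_eq_self[of "\<zero>\<^sub>m X Y \<cdot> f" "\<zero>\<^sub>m X Y \<cdot> f"] by (simp add: assms O that del: cmp_plus)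
  qed
  show "f \<cdot> \<zero>\<^sub>m X Y = \<zero>\<^sub>m X (target T f)" if "Y = source T f" "X \<in> Obj T"
  proof -
    have "(f \<cdot> \<zero>\<^sub>m X Y) \<^bold>+ (f \<cdot> \<zero>\<^sub>m X Y) = f \<cdot> (\<zero>\<^sub>m X Y \<^bold>+ \<zero>\<^sub>m X Y)"
      by (rule cmp_plus(2)[symmetric]) (simp_all add: assms O that)
    then show ?thesis
      using plus_eq_self[of "f \<cdot> \<zero>\<^sub>m X Y" "f \<cdot> \<zero>\<^sub>m X Y"] by (simp add: assms O that del: cmp_plus)
  qed
qed

lemma cmp_neg [simp]:
  assumes "f \<in> Arr T" "g \<in> Arr T" "source T g = target T f"
  shows "neg_arr T g \<cdot> f = neg_arr T (g \<cdot> f)" "g \<cdot> neg_arr T f = neg_arr T (g \<cdot> f)"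
proof -
  have O: "source T f \<in> Obj T" "target T g \<in> Obj T" using assms source_in_Obj target_in_Obj by auto
  show "neg_arr T g \<cdot> f = neg_arr T (g \<cdot> f)"
    using cmp_plus(1)[of f g "neg_arr T g"] assms O by (intro neg_unique) simp_all
  show "g \<cdot> neg_arr T f = neg_arr T (g \<cdot> f)"
    using cmp_plus(2)[of g f "neg_arr T f"] assms O by (intro neg_unique) simp_all
qed

lemma to_zero_object:
  assumes "zero_object T Z" "f \<in> hom T X Z" "g \<in> hom T X Z"
  shows "f = g"
  using assms hom_Obj(1) unfolding zero_object_def by blast

section \<open>Biproducts\<close>

lemma biproductD:
  assumes "biproduct T A B (P, i1, i2, p1, p2)"
  shows "A \<in> Obj T" "B \<in> Obj T" "P \<in> Obj T"
    "i1 \<in> hom T A P" "i2 \<in> hom T B P" "p1 \<in> hom T P A" "p2 \<in> hom T P B"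
    "p1 \<cdot> i1 = \<one>\<^sub>m A" "p2 \<cdot> i2 = \<one>\<^sub>m B" "p1 \<cdot> i2 = \<zero>\<^sub>m B A" "p2 \<cdot> i1 = \<zero>\<^sub>m A B"
    "(i1 \<cdot> p1) \<^bold>+ (i2 \<cdot> p2) = \<one>\<^sub>m P"
  using assms hom_Obj by (auto simp: biproduct_def)

text \<open>Composing with 1 = i1 p1 + i2 p2 recovers an arrow out of P from its two composites with
  the injections.\<close>

lemma biproduct_eqI:
  assumes "biproduct T A B (P, i1, i2, p1, p2)" "f \<in> hom T P W" "g \<in> hom T P W"
    and "f \<cdot> i1 = g \<cdot> i1" "f \<cdot> i2 = g \<cdot> i2"
  shows "f = g"
proof -
  note D = biproductD[OF assms(1)]
  note t = D(1-7)[unfolded hom_iff] assms(2,3)[unfolded hom_iff]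
  have "x = (x \<cdot> i1) \<cdot> p1 \<^bold>+ (x \<cdot> i2) \<cdot> p2" if "x \<in> hom T P W" for x
    using arg_cong[OF D(12), of "\<lambda>y. x \<cdot> y"] by (simp add: t that[unfolded hom_iff])
  from this[OF assms(2)] this[OF assms(3)] show ?thesis using assms(4,5) by simp
qed

text \<open>The structure maps transported along the automorphism \<open>(1, -F; 0, 1)\<close> of \<open>A \<oplus> B\<close>.\<close>

lemma biproduct_shear:
  assumes "biproduct T A B (P, i1, i2, p1, p2)" "F \<in> hom T B A"
  shows "biproduct T A B (P, i1, i2 \<^bold>+ neg_arr T (i1 \<cdot> F), p1 \<^bold>+ (F \<cdot> p2), p2)"
proof -
  note D = biproductD[OF assms(1)]
  note t = D(1-7)[unfolded hom_iff] assms(2)[unfolded hom_iff]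
  note r = D(8-11) D(8-11)[THEN cmp_reassoc]
  \<comment> \<open>Expanding the two idempotents of the sheared structure adds i1 F p2 to one and
    subtracts it from the other, so their sum is still the identity.\<close>
  have "i1 \<cdot> (F \<cdot> p2) \<^bold>+ neg_arr T (i1 \<cdot> (F \<cdot> p2)) = \<zero>\<^sub>m P P"
    by (simp add: t)
  then have "i1 \<cdot> (p1 \<^bold>+ (F \<cdot> p2)) \<^bold>+ (i2 \<^bold>+ neg_arr T (i1 \<cdot> F)) \<cdot> p2 = (i1 \<cdot> p1) \<^bold>+ (i2 \<cdot> p2)"
    by (simp add: t plus_assoc plus_left_comm[of "i1 \<cdot> (F \<cdot> p2)" "i2 \<cdot> p2"])
  then show ?thesis
    by (simp add: biproduct_def hom_iff t r D(12))
qed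

lemma bip:
  assumes "A \<in> Obj T" "B \<in> Obj T"
  shows "biproduct T A B (bip_obj T A B, inj1 T A B, inj2 T A B, proj1 T A B, proj2 T A B)"
  using someI_ex[OF biproduct_exists[OF assms]]
  by (cases "bip T A B") (simp add: bip_def[symmetric] bip_obj_def inj1_def inj2_def proj1_def proj2_def)

text \<open>From here on a matrix is used only through its two columns, the composites with the
  injections; by \<open>biproduct_eqI\<close> they determine it.\<close>

lemma matrix_arr:
  assumes "a \<in> hom T A C" "b \<in> hom T B C" "c \<in> hom T A D" "d \<in> hom T B D"
  shows "matrix_arr T A B C D a b c d \<in> hom T (bip_obj T A B) (bip_obj T C D)"
    "matrix_arr T A B C D a b c d \<cdot> inj1 T A B = (inj1 T C D \<cdot> a) \<^bold>+ (inj2 T C D \<cdot> c)"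
    "matrix_arr T A B C D a b c d \<cdot> inj2 T A B = (inj1 T C D \<cdot> b) \<^bold>+ (inj2 T C D \<cdot> d)"
proof -
  have O: "A \<in> Obj T" "B \<in> Obj T" "C \<in> Obj T" "D \<in> Obj T" using assms hom_Obj by auto
  note D = biproductD[OF bip[OF O(1,2)]] and D' = biproductD[OF bip[OF O(3,4)]]
  note t = D(3-7)[unfolded hom_iff] D'(3-7)[unfolded hom_iff] assms[unfolded hom_iff] O
  note r = D(8-11)
  show "matrix_arr T A B C D a b c d \<in> hom T (bip_obj T A B) (bip_obj T C D)"
    "matrix_arr T A B C D a b c d \<cdot> inj1 T A B = (inj1 T C D \<cdot> a) \<^bold>+ (inj2 T C D \<cdot> c)"
    "matrix_arr T A B C D a b c d \<cdot> inj2 T A B = (inj1 T C D \<cdot> b) \<^bold>+ (inj2 T C D \<cdot> d)"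
    by (simp_all add: matrix_arr_def hom_iff t r)
qed

end

section \<open>Exact triangles\<close>

context triangulated_category
begin

section \<open>The suspension as an additive, fully faithful functor\<close>

lemma susp_Obj [simp]: "X \<in> Obj T \<Longrightarrow> \<Sigma>\<^sub>o X \<in> Obj T"
  using susp_equivalence by (simp add: self_equivalence_def endofunctor_def)

lemma susp_ident [simp]: "X \<in> Obj T \<Longrightarrow> \<Sigma> (\<one>\<^sub>m X) = \<one>\<^sub>m (\<Sigma>\<^sub>o X)"
  using susp_equivalence by (simp add: self_equivalence_def endofunctor_def)

lemma susp_in_hom: "f \<in> hom T X Y \<Longrightarrow> \<Sigma> f \<in> hom T (\<Sigma>\<^sub>o X) (\<Sigma>\<^sub>o Y)"
  using susp_equivalence hom_Obj by (simp add: self_equivalence_def endofunctor_def)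

lemma susp_Arr [simp]:
  assumes "f \<in> Arr T"
  shows "\<Sigma> f \<in> Arr T" "source T (\<Sigma> f) = \<Sigma>\<^sub>o (source T f)" "target T (\<Sigma> f) = \<Sigma>\<^sub>o (target T f)"
  using susp_in_hom[of f "source T f" "target T f"] assms by (auto simp: hom_iff)

lemma susp_cmp [simp]:
  "f \<in> Arr T \<Longrightarrow> g \<in> Arr T \<Longrightarrow> source T g = target T f \<Longrightarrow> \<Sigma> (g \<cdot> f) = \<Sigma> g \<cdot> \<Sigma> f"
  using susp_equivalence by (simp add: self_equivalence_def endofunctor_def)

lemma susp_plus_arr [simp]:
  "\<lbrakk>f \<in> Arr T; g \<in> Arr T; source T g = source T f; target T g = target T f\<rbrakk>
   \<Longrightarrow> \<Sigma> (f \<^bold>+ g) = \<Sigma> f \<^bold>+ \<Sigma> g"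
  using susp_plus by (simp add: hom_iff)

lemma susp_zero [simp]:
  assumes "X \<in> Obj T" "Y \<in> Obj T"
  shows "\<Sigma> (\<zero>\<^sub>m X Y) = \<zero>\<^sub>m (\<Sigma>\<^sub>o X) (\<Sigma>\<^sub>o Y)"
proof -
  have "\<Sigma> (\<zero>\<^sub>m X Y) \<^bold>+ \<Sigma> (\<zero>\<^sub>m X Y) = \<Sigma> (\<zero>\<^sub>m X Y \<^bold>+ \<zero>\<^sub>m X Y)"
    by (rule susp_plus_arr[symmetric]) (simp_all add: assms)
  then show ?thesis
    using plus_eq_self[of "\<Sigma> (\<zero>\<^sub>m X Y)" "\<Sigma> (\<zero>\<^sub>m X Y)"] by (simp add: assms del: susp_plus_arr)
qed

lemma susp_neg [simp]:
  assumes "f \<in> Arr T"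
  shows "\<Sigma> (neg_arr T f) = neg_arr T (\<Sigma> f)"
proof (rule neg_unique)
  have "\<Sigma> f \<^bold>+ \<Sigma> (neg_arr T f) = \<Sigma> (f \<^bold>+ neg_arr T f)"
    by (rule susp_plus_arr[symmetric]) (simp_all add: assms)
  then show "\<Sigma> f \<^bold>+ \<Sigma> (neg_arr T f) = \<zero>\<^sub>m (source T (\<Sigma> f)) (target T (\<Sigma> f))"
    by (simp add: assms source_in_Obj target_in_Obj)
qed (simp_all add: assms)

lemma susp_desusp:
  assumes "X \<in> Obj T" "Y \<in> Obj T" "k \<in> hom T (\<Sigma>\<^sub>o X) (\<Sigma>\<^sub>o Y)"
  shows "desusp T X Y k \<in> hom T X Y" "\<Sigma> (desusp T X Y k) = k"
  using theI'[OF desusp_unique[OF assms]] by (simp_all add: desusp_def)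

text \<open>The uniqueness half of \<open>desusp_unique\<close>; it allows equations of arrows to be
  checked after suspending.\<close>

lemma susp_faithful:
  assumes "f \<in> hom T X Y" "g \<in> hom T X Y" "\<Sigma> f = \<Sigma> g"
  shows "f = g"
  using desusp_unique[OF hom_Obj[OF assms(1)] susp_in_hom[OF assms(1)]] assms by metis

text \<open>An object is zero as soon as its identity is a zero arrow, and this equation survives
  \<Sigma> by additivity.\<close>

lemma zero_object_susp:
  assumes "zero_object T Z"
  shows "zero_object T (\<Sigma>\<^sub>o Z)"
proof -
  have Z: "Z \<in> Obj T" using assms by (simp add: zero_object_def)
  have "\<one>\<^sub>m Z = \<zero>\<^sub>m Z Z" using assms by (rule to_zero_object) (simp_all add: hom_iff Z)
  then have *: "\<one>\<^sub>m (\<Sigma>\<^sub>o Z) = \<zero>\<^sub>m (\<Sigma>\<^sub>o Z) (\<Sigma>\<^sub>o Z)" using Z susp_ident susp_zero by metis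
  have "f = \<zero>\<^sub>m X (\<Sigma>\<^sub>o Z)" if "f \<in> hom T X (\<Sigma>\<^sub>o Z)" for f X
  proof -
    have "\<one>\<^sub>m (\<Sigma>\<^sub>o Z) \<cdot> f = \<zero>\<^sub>m (\<Sigma>\<^sub>o Z) (\<Sigma>\<^sub>o Z) \<cdot> f" by (simp only: *)
    then show ?thesis using that Z by (simp add: hom_iff)
  qed
  moreover have "f = \<zero>\<^sub>m (\<Sigma>\<^sub>o Z) X" if "f \<in> hom T (\<Sigma>\<^sub>o Z) X" for f X
  proof -
    have "f \<cdot> \<one>\<^sub>m (\<Sigma>\<^sub>o Z) = f \<cdot> \<zero>\<^sub>m (\<Sigma>\<^sub>o Z) (\<Sigma>\<^sub>o Z)" by (simp only: *)
    then show ?thesis using that Z by (simp add: hom_iff)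
  qed
  moreover have "\<zero>\<^sub>m X (\<Sigma>\<^sub>o Z) \<in> hom T X (\<Sigma>\<^sub>o Z)" "\<zero>\<^sub>m (\<Sigma>\<^sub>o Z) X \<in> hom T (\<Sigma>\<^sub>o Z) X"
    if "X \<in> Obj T" for X using that Z by (simp_all add: hom_iff)
  ultimately show ?thesis
    unfolding zero_object_def using susp_Obj[OF Z] by (intro conjI ballI) (assumption | metis)+
qed

section \<open>Vanishing composites, weak cokernels and weak kernels\<close>

lemma exactE:
  assumes "(u, v, w) \<in> exact T"
  obtains X Y Z where "X \<in> Obj T" "Y \<in> Obj T" "Z \<in> Obj T"
    "u \<in> hom T X Y" "v \<in> hom T Y Z" "w \<in> hom T Z (\<Sigma>\<^sub>o X)"
  using exact_candidate[OF assms] that[of "source T u" "source T v" "source T w"]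
    source_in_Obj target_in_Obj
  by (simp add: hom_iff)

lemma exact_rotate':
  assumes "(u, v, w) \<in> exact T"
  shows "(v, w, neg_arr T (\<Sigma> u)) \<in> exact T"
  using exact_rotate[OF exact_candidate[OF assms]] assms by simp

text \<open>The triangle X = X -> 0 -> \<Sigma>X maps to (u, v, w) by the identity of X and u; the
  filler shows that v u factors through a zero object.\<close>

lemma exact_cmp_zero:
  assumes "(u, v, w) \<in> exact T" "u \<in> hom T X Y" "v \<in> hom T Y Z"
  shows "v \<cdot> u = \<zero>\<^sub>m X Z"
proof -
  obtain N where N: "zero_object T N" using zero_object_exists by blast
  then have NO: "N \<in> Obj T" by (simp add: zero_object_def)
  note t = assms(2,3)[unfolded hom_iff] hom_Obj[OF assms(2)] hom_Obj[OF assms(3)] NO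
  obtain h where "triangle_map T (\<one>\<^sub>m X, \<zero>\<^sub>m X N, \<zero>\<^sub>m N (\<Sigma>\<^sub>o X)) (u, v, w) (\<one>\<^sub>m X, u, h)"
    using exact_fill[OF exact_ident[OF _ N] assms(1), of X "\<one>\<^sub>m X" u] t by (auto simp: hom_iff)
  moreover have "source T w = Z"
    using exact_candidate[OF assms(1)] t by simp
  ultimately have "h \<in> hom T N Z" "h \<cdot> \<zero>\<^sub>m X N = v \<cdot> u" using t by simp_all
  then show ?thesis using t by (auto simp: hom_iff)
qed

text \<open>Its rotation is the identity triangle on Z, with \<Sigma>N as the zero object.\<close>

lemma exact_zero_ident:
  assumes "zero_object T N" "Z \<in> Obj T"
  shows "(\<zero>\<^sub>m N Z, \<one>\<^sub>m Z, \<zero>\<^sub>m Z (\<Sigma>\<^sub>o N)) \<in> exact T"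
proof -
  have NO: "N \<in> Obj T" using assms by (simp add: zero_object_def)
  show ?thesis
    using exact_rotate[of "\<zero>\<^sub>m N Z" "\<one>\<^sub>m Z" "\<zero>\<^sub>m Z (\<Sigma>\<^sub>o N)"] NO assms(2)
      exact_ident[OF assms(2) zero_object_susp[OF assms(1)]] by simp
qed

text \<open>The arrow d, together with zero on X, extends to a map into the triangle 0 -> D = D ->
  \<Sigma>0; its third component is the factorisation.\<close>

lemma exact_weak_cokernel:
  assumes "(u, v, w) \<in> exact T" "u \<in> hom T X Y" "v \<in> hom T Y Z" "d \<in> hom T Y D"
    and "d \<cdot> u = \<zero>\<^sub>m X D"
  shows "\<exists>k \<in> hom T Z D. d = k \<cdot> v"
proof -
  obtain N where N: "zero_object T N" using zero_object_exists by blast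
  then have NO: "N \<in> Obj T" by (simp add: zero_object_def)
  have O: "X \<in> Obj T" "Y \<in> Obj T" "Z \<in> Obj T" "D \<in> Obj T" using assms hom_Obj by auto
  note t = assms(2-4)[unfolded hom_iff] O NO
  obtain h where "triangle_map T (u, v, w) (\<zero>\<^sub>m N D, \<one>\<^sub>m D, \<zero>\<^sub>m D (\<Sigma>\<^sub>o N)) (\<zero>\<^sub>m X N, d, h)"
    using exact_fill[OF assms(1) exact_zero_ident[OF N O(4)], of "\<zero>\<^sub>m X N" d] t assms(5)
    by (auto simp: hom_iff)
  moreover have "source T w = Z"
    using exact_candidate[OF assms(1)] t by simp
  ultimately have "h \<in> hom T Z D" "h \<cdot> v = d" using t by simp_all
  then show ?thesis by auto
qed

text \<open>\<open>exact_fill\<close> supplies only a third component, so both triangles are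
  rotated: d and zero are completed to a map from D -> 0 -> \<Sigma>D to Y -> Z -> \<Sigma>X. The
  filler goes from \<Sigma>D to \<Sigma>X and is desuspended to k.\<close>

lemma exact_weak_kernel:
  assumes "(u, v, w) \<in> exact T" "u \<in> hom T X Y" "v \<in> hom T Y Z" "d \<in> hom T D Y"
    and "v \<cdot> d = \<zero>\<^sub>m D Z"
  shows "\<exists>k \<in> hom T D X. d = u \<cdot> k"
proof -
  obtain N where N: "zero_object T N" using zero_object_exists by blast
  then have NO: "N \<in> Obj T" by (simp add: zero_object_def)
  have O: "X \<in> Obj T" "Y \<in> Obj T" "Z \<in> Obj T" "D \<in> Obj T" using assms hom_Obj by auto
  have w: "w \<in> hom T Z (\<Sigma>\<^sub>o X)"
    using exact_candidate[OF assms(1)] assms(2,3) by (simp add: hom_iff)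
  note t = assms(2-4)[unfolded hom_iff] O NO w[unfolded hom_iff]
  obtain h where "triangle_map T (\<zero>\<^sub>m D N, \<zero>\<^sub>m N (\<Sigma>\<^sub>o D), neg_arr T (\<one>\<^sub>m (\<Sigma>\<^sub>o D)))
      (v, w, neg_arr T (\<Sigma> u)) (d, \<zero>\<^sub>m N Z, h)"
    using exact_fill[OF exact_rotate'[OF exact_ident[OF O(4) N]] exact_rotate'[OF assms(1)], of d "\<zero>\<^sub>m N Z"]
      t assms(5)
    by (auto simp: hom_iff)
  then have h: "h \<in> hom T (\<Sigma>\<^sub>o D) (\<Sigma>\<^sub>o X)"
    "\<Sigma> d \<cdot> neg_arr T (\<one>\<^sub>m (\<Sigma>\<^sub>o D)) = neg_arr T (\<Sigma> u) \<cdot> h"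
    using t by simp_all
  obtain k where k: "k \<in> hom T D X" "\<Sigma> k = h"
    using susp_desusp[OF O(4,1) h(1)] by blast
  \<comment> \<open>Both rotated triangles end in a negated suspension, so the two signs cancel
    before faithfulness of \<Sigma> is applied.\<close>
  have "neg_arr T (\<Sigma> d) = neg_arr T (\<Sigma> u \<cdot> h)" using h t by (simp add: hom_iff)
  then have "\<Sigma> d = \<Sigma> u \<cdot> h" using neg_neg t h by (metis (no_types, lifting) cmp_Arr(1) susp_Arr hom_iff)
  then have "\<Sigma> d = \<Sigma> (u \<cdot> k)" using k t by (simp add: hom_iff)
  then have "d = u \<cdot> k" using susp_faithful[of d D Y "u \<cdot> k"] t k by (simp add: hom_iff)
  then show ?thesis using k by blast
qed

text \<open>Rotating twice puts w before -\<Sigma>u, and the kernel condition does not see the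
  sign.\<close>

lemma exact_weak_kernel_susp:
  assumes "(u, v, w) \<in> exact T" "u \<in> hom T X Y" "w \<in> hom T Z (\<Sigma>\<^sub>o X)" "d \<in> hom T D (\<Sigma>\<^sub>o X)"
    and "\<Sigma> u \<cdot> d = \<zero>\<^sub>m D (\<Sigma>\<^sub>o Y)"
  shows "\<exists>k \<in> hom T D Z. d = w \<cdot> k"
proof -
  have O: "D \<in> Obj T" "\<Sigma>\<^sub>o Y \<in> Obj T" using assms hom_Obj(1)[OF assms(4)] hom_Obj(2)[OF assms(2)] by auto
  note t = assms(2-4)[unfolded hom_iff]
  show ?thesis
    by (rule exact_weak_kernel[OF exact_rotate'[OF exact_rotate'[OF assms(1)]]])
      (use assms(3,4) in \<open>simp_all add: assms(5) t O hom_iff\<close>)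
qed

section \<open>Direct sums of triangles\<close>

text \<open>The defining equations of a biproduct involve only sums, composites, identities and zero
  arrows, all of which \<Sigma> preserves.\<close>

lemma biproduct_susp:
  assumes "biproduct T A B (P, i1, i2, p1, p2)"
  shows "biproduct T (\<Sigma>\<^sub>o A) (\<Sigma>\<^sub>o B) (\<Sigma>\<^sub>o P, \<Sigma> i1, \<Sigma> i2, \<Sigma> p1, \<Sigma> p2)"
proof -
  note D = biproductD[OF assms]
  note t = D(1-7)[unfolded hom_iff]
  have "\<Sigma> p1 \<cdot> \<Sigma> i1 = \<one>\<^sub>m (\<Sigma>\<^sub>o A)" "\<Sigma> p2 \<cdot> \<Sigma> i2 = \<one>\<^sub>m (\<Sigma>\<^sub>o B)" "\<Sigma> p1 \<cdot> \<Sigma> i2 = \<zero>\<^sub>m (\<Sigma>\<^sub>o B) (\<Sigma>\<^sub>o A)"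
    "\<Sigma> p2 \<cdot> \<Sigma> i1 = \<zero>\<^sub>m (\<Sigma>\<^sub>o A) (\<Sigma>\<^sub>o B)" "(\<Sigma> i1 \<cdot> \<Sigma> p1) \<^bold>+ (\<Sigma> i2 \<cdot> \<Sigma> p2) = \<one>\<^sub>m (\<Sigma>\<^sub>o P)"
    using D(8-12)[THEN arg_cong, of "susp T"] by (simp_all add: t)
  then show ?thesis by (simp add: biproduct_def hom_iff t)
qed

text \<open>
  The five lemma: the comparison from \<open>(a, b, c)\<close> to an exact triangle on \<open>a\<close> is bijective on
  \<open>Hom(W, -)\<close>, since the long sequence of \<open>(a, b, c)\<close> is exact on the summands.
\<close>

lemma exact_biproduct:
  assumes t1: "(u1, v1, w1) \<in> exact T" and t2: "(u2, v2, w2) \<in> exact T"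
    and BX: "biproduct T (source T u1) (source T u2) (X, i1, i2, p1, p2)"
    and BY: "biproduct T (source T v1) (source T v2) (Y, j1, j2, q1, q2)"
    and BZ: "biproduct T (source T w1) (source T w2) (Z, k1, k2, r1, r2)"
    and cand: "candidate_triangle T (a, b, c)"
    and \<iota>1: "triangle_map T (u1, v1, w1) (a, b, c) (i1, j1, k1)"
    and \<iota>2: "triangle_map T (u2, v2, w2) (a, b, c) (i2, j2, k2)"
  shows "(a, b, c) \<in> exact T"
proof -
  obtain X1 Y1 Z1 where T1: "X1 \<in> Obj T" "Y1 \<in> Obj T" "Z1 \<in> Obj T"
    "u1 \<in> hom T X1 Y1" "v1 \<in> hom T Y1 Z1" "w1 \<in> hom T Z1 (\<Sigma>\<^sub>o X1)" using t1 by (rule exactE)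
  obtain X2 Y2 Z2 where T2: "X2 \<in> Obj T" "Y2 \<in> Obj T" "Z2 \<in> Obj T"
    "u2 \<in> hom T X2 Y2" "v2 \<in> hom T Y2 Z2" "w2 \<in> hom T Z2 (\<Sigma>\<^sub>o X2)" using t2 by (rule exactE)
  note s = T1[unfolded hom_iff] T2[unfolded hom_iff]
  have BX': "biproduct T X1 X2 (X, i1, i2, p1, p2)" using BX by (simp add: s)
  have BY': "biproduct T Y1 Y2 (Y, j1, j2, q1, q2)" using BY by (simp add: s)
  have BZ': "biproduct T Z1 Z2 (Z, k1, k2, r1, r2)" using BZ by (simp add: s)
  note BS = biproduct_susp[OF BX']
  note DX = biproductD[OF BX'] and DY = biproductD[OF BY'] and DZ = biproductD[OF BZ']
    and DS = biproductD[OF BS]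
  have abc: "a \<in> hom T X Y" "b \<in> hom T Y Z" "c \<in> hom T Z (\<Sigma>\<^sub>o X)"
    using cand \<iota>1 DX(4) DY(4) DZ(4) by (auto simp: hom_iff)
  note s = s DX(1-7)[unfolded hom_iff] DY(1-7)[unfolded hom_iff] DZ(1-7)[unfolded hom_iff]
    abc[unfolded hom_iff]
  have e: "a \<cdot> i1 = j1 \<cdot> u1" "a \<cdot> i2 = j2 \<cdot> u2" "b \<cdot> j1 = k1 \<cdot> v1" "b \<cdot> j2 = k2 \<cdot> v2"
    "c \<cdot> k1 = \<Sigma> i1 \<cdot> w1" "c \<cdot> k2 = \<Sigma> i2 \<cdot> w2"
    using \<iota>1 \<iota>2 by simp_all
  note e' = e e[THEN cmp_reassoc]
  note bx = DX(8-11) DX(8-11)[THEN cmp_reassoc]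
  note bY = DY(8-11) DY(8-11)[THEN cmp_reassoc]
  note bz = DZ(8-11) DZ(8-11)[THEN cmp_reassoc]
  note bs = DS(8-11) DS(8-11)[THEN cmp_reassoc]
  have z1: "v1 \<cdot> u1 = \<zero>\<^sub>m X1 Z1" "v2 \<cdot> u2 = \<zero>\<^sub>m X2 Z2"
    using exact_cmp_zero t1 t2 T1 T2 by blast+
  have ba: "b \<cdot> a = \<zero>\<^sub>m X Z"
    using biproduct_eqI[OF BX', of "b \<cdot> a" Z "\<zero>\<^sub>m X Z"] z1 by (simp add: hom_iff s e')
  \<comment> \<open>The hypotheses give compatibility with the injections. Testing on both
    injections shows that the projections commute with the three arrows as well.\<close>
  have qa: "q1 \<cdot> a = u1 \<cdot> p1" "q2 \<cdot> a = u2 \<cdot> p2"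
    using biproduct_eqI[OF BX', of "q1 \<cdot> a" Y1 "u1 \<cdot> p1"]
      biproduct_eqI[OF BX', of "q2 \<cdot> a" Y2 "u2 \<cdot> p2"] by (simp_all add: hom_iff s e' bx bY)
  have rb: "r1 \<cdot> b = v1 \<cdot> q1" "r2 \<cdot> b = v2 \<cdot> q2"
    using biproduct_eqI[OF BY', of "r1 \<cdot> b" Z1 "v1 \<cdot> q1"]
      biproduct_eqI[OF BY', of "r2 \<cdot> b" Z2 "v2 \<cdot> q2"] by (simp_all add: hom_iff s e' bz bY)
  have pc: "\<Sigma> p1 \<cdot> c = w1 \<cdot> r1" "\<Sigma> p2 \<cdot> c = w2 \<cdot> r2"
    using biproduct_eqI[OF BZ', of "\<Sigma> p1 \<cdot> c" "\<Sigma>\<^sub>o X1" "w1 \<cdot> r1"]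
      biproduct_eqI[OF BZ', of "\<Sigma> p2 \<cdot> c" "\<Sigma>\<^sub>o X2" "w2 \<cdot> r2"] by (simp_all add: hom_iff s e' bz bs)
  have decZ: "y = (k1 \<cdot> (r1 \<cdot> y)) \<^bold>+ (k2 \<cdot> (r2 \<cdot> y))" if "y \<in> hom T W Z" for y W
    using arg_cong[OF DZ(12), of "\<lambda>x. x \<cdot> y"] that by (simp add: hom_iff s)
  have decS: "y = (\<Sigma> i1 \<cdot> (\<Sigma> p1 \<cdot> y)) \<^bold>+ (\<Sigma> i2 \<cdot> (\<Sigma> p2 \<cdot> y))" if "y \<in> hom T W (\<Sigma>\<^sub>o X)" for y W
    using arg_cong[OF DS(12), of "\<lambda>x. x \<cdot> y"] that by (simp add: hom_iff s)
  \<comment> \<open>Exactness of Hom(W, -) at \<Sigma>X: the components of y are killed by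
    \<Sigma>u1 and \<Sigma>u2, lift separately through w1 and w2, and the lifts are added.\<close>
  have exS: "\<exists>z \<in> hom T W Z. y = c \<cdot> z"
    if y: "y \<in> hom T W (\<Sigma>\<^sub>o X)" and 0: "\<Sigma> a \<cdot> y = \<zero>\<^sub>m W (\<Sigma>\<^sub>o Y)" for y W
  proof -
    note y' = y[unfolded hom_iff] hom_Obj(1)[OF y]
    have "\<Sigma> u1 \<cdot> (\<Sigma> p1 \<cdot> y) = \<Sigma> q1 \<cdot> (\<Sigma> a \<cdot> y)" "\<Sigma> u2 \<cdot> (\<Sigma> p2 \<cdot> y) = \<Sigma> q2 \<cdot> (\<Sigma> a \<cdot> y)"
      using qa[THEN arg_cong, of "\<lambda>x. \<Sigma> x \<cdot> y"] by (simp_all add: s y')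
    then have "\<Sigma> u1 \<cdot> (\<Sigma> p1 \<cdot> y) = \<zero>\<^sub>m W (\<Sigma>\<^sub>o Y1)" "\<Sigma> u2 \<cdot> (\<Sigma> p2 \<cdot> y) = \<zero>\<^sub>m W (\<Sigma>\<^sub>o Y2)"
      by (simp_all add: 0 s y')
    then obtain y1 y2 where "y1 \<in> hom T W Z1" "\<Sigma> p1 \<cdot> y = w1 \<cdot> y1" "y2 \<in> hom T W Z2" "\<Sigma> p2 \<cdot> y = w2 \<cdot> y2"
      using exact_weak_kernel_susp[OF t1 T1(4,6), of "\<Sigma> p1 \<cdot> y" W]
        exact_weak_kernel_susp[OF t2 T2(4,6), of "\<Sigma> p2 \<cdot> y" W] by (auto simp: hom_iff s y')
    then show ?thesis
      using decS[OF y] by (intro bexI[of _ "(k1 \<cdot> y1) \<^bold>+ (k2 \<cdot> y2)"]) (simp_all add: hom_iff s e')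
  qed
  \<comment> \<open>The same argument one place earlier, at Z, with lifts through v1 and v2.\<close>
  have exZ: "\<exists>z \<in> hom T W Y. y = b \<cdot> z"
    if y: "y \<in> hom T W Z" and 0: "c \<cdot> y = \<zero>\<^sub>m W (\<Sigma>\<^sub>o X)" for y W
  proof -
    note y' = y[unfolded hom_iff] hom_Obj(1)[OF y]
    have "w1 \<cdot> (r1 \<cdot> y) = \<Sigma> p1 \<cdot> (c \<cdot> y)" "w2 \<cdot> (r2 \<cdot> y) = \<Sigma> p2 \<cdot> (c \<cdot> y)"
      using pc[THEN arg_cong, of "\<lambda>x. x \<cdot> y"] by (simp_all add: s y')
    then have "w1 \<cdot> (r1 \<cdot> y) = \<zero>\<^sub>m W (\<Sigma>\<^sub>o X1)" "w2 \<cdot> (r2 \<cdot> y) = \<zero>\<^sub>m W (\<Sigma>\<^sub>o X2)"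
      by (simp_all add: 0 s y')
    then obtain y1 y2 where "y1 \<in> hom T W Y1" "r1 \<cdot> y = v1 \<cdot> y1" "y2 \<in> hom T W Y2" "r2 \<cdot> y = v2 \<cdot> y2"
      using exact_weak_kernel[OF exact_rotate'[OF t1] T1(5,6), of "r1 \<cdot> y" W]
        exact_weak_kernel[OF exact_rotate'[OF t2] T2(5,6), of "r2 \<cdot> y" W] by (auto simp: hom_iff s y')
    then show ?thesis
      using decZ[OF y] by (intro bexI[of _ "(j1 \<cdot> y1) \<^bold>+ (j2 \<cdot> y2)"]) (simp_all add: hom_iff s e')
  qed
  obtain p q where pq: "(a, p, q) \<in> exact T" using exact_completion[of a] s by blast
  then obtain C where C: "C \<in> Obj T" "p \<in> hom T Y C" "q \<in> hom T C (\<Sigma>\<^sub>o X)"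
    by (rule exactE) (auto simp: hom_iff s)
  note s = s C[unfolded hom_iff]
  obtain h1 where h1: "h1 \<in> hom T Z1 C" "h1 \<cdot> v1 = p \<cdot> j1" "q \<cdot> h1 = \<Sigma> i1 \<cdot> w1"
    using exact_fill[OF t1 pq, of i1 j1] e by (auto simp: hom_iff s)
  obtain h2 where h2: "h2 \<in> hom T Z2 C" "h2 \<cdot> v2 = p \<cdot> j2" "q \<cdot> h2 = \<Sigma> i2 \<cdot> w2"
    using exact_fill[OF t2 pq, of i2 j2] e by (auto simp: hom_iff s)
  \<comment> \<open>The fillers on the two summands are combined along the biproduct Z, so that h
    with two identities is a map from (a, b, c) to the exact triangle (a, p, q).\<close>
  define h where "h = (h1 \<cdot> r1) \<^bold>+ (h2 \<cdot> r2)"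
  note s = s h1(1)[unfolded hom_iff] h2(1)[unfolded hom_iff]
  have h: "h \<in> hom T Z C" by (simp add: h_def hom_iff s)
  have hk: "h \<cdot> k1 = h1" "h \<cdot> k2 = h2" by (simp_all add: h_def s bz)
  note s = s h[unfolded hom_iff]
  have hb: "h \<cdot> b = p"
    using biproduct_eqI[OF BY', of "h \<cdot> b" C p] hk[THEN cmp_reassoc] h1 h2 by (simp add: hom_iff s e')
  have qh: "q \<cdot> h = c"
    using biproduct_eqI[OF BZ', of "q \<cdot> h" "\<Sigma>\<^sub>o X" c] hk h1 h2 by (simp add: hom_iff s e')
  note hb' = hb[THEN cmp_reassoc] and qh' = qh[THEN cmp_reassoc]
  have qp: "q \<cdot> p = \<zero>\<^sub>m Y (\<Sigma>\<^sub>o X)" using exact_cmp_zero[OF exact_rotate'[OF pq]] C by blast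
  have aq: "\<Sigma> a \<cdot> q = \<zero>\<^sub>m C (\<Sigma>\<^sub>o Y)"
  proof -
    have "neg_arr T (\<Sigma> a) \<cdot> q = \<zero>\<^sub>m C (\<Sigma>\<^sub>o Y)"
      using exact_cmp_zero[OF exact_rotate'[OF exact_rotate'[OF pq]], of C "\<Sigma>\<^sub>o X" "\<Sigma>\<^sub>o Y"]
      by (simp add: hom_iff s)
    from arg_cong[OF this, of "neg_arr T"] show ?thesis by (simp add: s)
  qed
  \<comment> \<open>Diagram chase: c z = q h z = 0 gives z = b x; then p x = h z = 0 gives x = a x',
    and z = b a x' = 0.\<close>
  have inj: "z = \<zero>\<^sub>m W Z" if z: "z \<in> hom T W Z" and 0: "h \<cdot> z = \<zero>\<^sub>m W C" for z W
  proof -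
    note z' = z[unfolded hom_iff] hom_Obj(1)[OF z]
    have "c \<cdot> z = q \<cdot> (h \<cdot> z)" by (simp add: s z' qh')
    then obtain x where x: "x \<in> hom T W Y" "z = b \<cdot> x" using exZ[OF z] by (auto simp: 0 s z')
    have "p \<cdot> x = h \<cdot> z" using x s by (simp add: hom_iff hb')
    then obtain x' where "x' \<in> hom T W X" "x = a \<cdot> x'"
      using exact_weak_kernel[OF pq abc(1) C(2) x(1)] 0 by auto
    then show ?thesis using x cmp_reassoc[OF ba] by (simp add: hom_iff s z')
  qed
  \<comment> \<open>Surjectivity is applied to the identity of C: from q = c z follows q h z = q, so
    1 - h z factors as p x, and adding b x to z gives a right inverse of h because h b = p.\<close>
  obtain z where z: "z \<in> hom T C Z" "q = c \<cdot> z" using exS[OF C(3) aq] by blast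
  note s = s z(1)[unfolded hom_iff]
  have "q \<cdot> (\<one>\<^sub>m C \<^bold>+ neg_arr T (h \<cdot> z)) = \<zero>\<^sub>m C (\<Sigma>\<^sub>o X)"
  proof -
    have "q \<cdot> (h \<cdot> z) = q" by (simp add: s qh' z(2)[symmetric])
    then show ?thesis by (simp add: s)
  qed
  then obtain x where x: "x \<in> hom T C Y" "\<one>\<^sub>m C \<^bold>+ neg_arr T (h \<cdot> z) = p \<cdot> x"
    using exact_weak_kernel[OF exact_rotate'[OF pq] C(2,3), of "\<one>\<^sub>m C \<^bold>+ neg_arr T (h \<cdot> z)" C]
    by (auto simp: hom_iff s)
  note s = s x(1)[unfolded hom_iff]
  define g where "g = z \<^bold>+ (b \<cdot> x)"
  have g: "g \<in> hom T C Z" by (simp add: g_def hom_iff s)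
  note s = s g[unfolded hom_iff]
  have hg: "h \<cdot> g = \<one>\<^sub>m C"
  proof -
    have "h \<cdot> g = (h \<cdot> z) \<^bold>+ (\<one>\<^sub>m C \<^bold>+ neg_arr T (h \<cdot> z))" unfolding x(2) by (simp add: g_def s hb')
    then show ?thesis by (simp add: s plus_left_comm[of _ "\<one>\<^sub>m C"])
  qed
  \<comment> \<open>Since h g = 1, the arrow h kills g h - 1, and injectivity makes g a two-sided
    inverse.\<close>
  have "(g \<cdot> h) \<^bold>+ neg_arr T (\<one>\<^sub>m Z) = \<zero>\<^sub>m Z Z"
    by (rule inj) (simp_all add: hom_iff s cmp_reassoc[OF hg])
  then have gh: "g \<cdot> h = \<one>\<^sub>m Z" using eq_if_diff_zero[of "g \<cdot> h" "\<one>\<^sub>m Z"] by (simp add: s)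
  have "g \<cdot> p = b" using cmp_reassoc[OF gh, of b] by (simp add: s hb)
  moreover have "c \<cdot> g = q" using cmp_reassoc[OF qh, of g] by (simp add: s hg)
  ultimately have "triangle_map T (a, p, q) (a, b, c) (\<one>\<^sub>m X, \<one>\<^sub>m Y, g)"
    by (simp add: hom_iff s)
  then show ?thesis
    by (rule exact_iso[OF pq cand]) (use iso_arrI[OF g h hg gh] in \<open>simp_all add: iso_arr_ident s\<close>)
qed

section \<open>Nullhomotopic maps are good\<close>

text \<open>Multiplication by -1 on the middle object identifies the rotated triangle with this one.
  The signs are those of the second rows of the mapping cone matrices.\<close>

lemma exact_rotate_neg:
  assumes "(u, v, w) \<in> exact T"
  shows "(neg_arr T v, neg_arr T w, neg_arr T (\<Sigma> u)) \<in> exact T"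
proof -
  obtain X Y Z where t: "X \<in> Obj T" "Y \<in> Obj T" "Z \<in> Obj T"
    "u \<in> hom T X Y" "v \<in> hom T Y Z" "w \<in> hom T Z (\<Sigma>\<^sub>o X)" using assms by (rule exactE)
  note s = t[unfolded hom_iff]
  have i: "iso_arr T (neg_arr T (\<one>\<^sub>m Z))"
    by (rule iso_arrI[of _ Z Z "neg_arr T (\<one>\<^sub>m Z)"]) (simp_all add: hom_iff s)
  show ?thesis
    by (rule exact_iso[OF exact_rotate'[OF assms],
          of _ "\<one>\<^sub>m Y" "neg_arr T (\<one>\<^sub>m Z)" "\<one>\<^sub>m (\<Sigma>\<^sub>o X)"])
      (simp_all add: i iso_arr_ident hom_iff s)
qed

text \<open>Applying \<Sigma> to the homotopy equation for f removes \<open>desusp\<close>; later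
  computations use this suspended form.\<close>

lemma nullhomotopicE:
  assumes "(u, v, w) \<in> exact T" "(u', v', w') \<in> exact T"
    and "nullhomotopic T (u, v, w) (u', v', w') (f, g, h)"
  obtains F G H where
    "F \<in> hom T (source T v) (source T u')" "G \<in> hom T (source T w) (source T v')"
    "H \<in> hom T (\<Sigma>\<^sub>o (source T u)) (source T w')"
    "\<Sigma> f = (\<Sigma> F \<cdot> \<Sigma> u) \<^bold>+ (w' \<cdot> H)" "g = (G \<cdot> v) \<^bold>+ (u' \<cdot> F)" "h = (H \<cdot> w) \<^bold>+ (v' \<cdot> G)"
proof -
  obtain X Y Z where t: "X \<in> Obj T" "Y \<in> Obj T" "Z \<in> Obj T"
    "u \<in> hom T X Y" "v \<in> hom T Y Z" "w \<in> hom T Z (\<Sigma>\<^sub>o X)" using assms(1) by (rule exactE)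
  obtain X' Y' Z' where t': "X' \<in> Obj T" "Y' \<in> Obj T" "Z' \<in> Obj T"
    "u' \<in> hom T X' Y'" "v' \<in> hom T Y' Z'" "w' \<in> hom T Z' (\<Sigma>\<^sub>o X')" using assms(2) by (rule exactE)
  note s = t[unfolded hom_iff] t'[unfolded hom_iff]
  obtain F G H where FGH: "F \<in> hom T Y X'" "G \<in> hom T Z Y'" "H \<in> hom T (\<Sigma>\<^sub>o X) Z'"
    and f: "f = (F \<cdot> u) \<^bold>+ desusp T X X' (w' \<cdot> H)"
    and gh: "g = (G \<cdot> v) \<^bold>+ (u' \<cdot> F)" "h = (H \<cdot> w) \<^bold>+ (v' \<cdot> G)"
    using assms(3) by (auto simp: s)
  have d: "desusp T X X' (w' \<cdot> H) \<in> hom T X X'" "\<Sigma> (desusp T X X' (w' \<cdot> H)) = w' \<cdot> H"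
    using susp_desusp[OF t(1) t'(1), of "w' \<cdot> H"] FGH(3) by (simp_all add: hom_iff s)
  have "\<Sigma> f = (\<Sigma> F \<cdot> \<Sigma> u) \<^bold>+ (w' \<cdot> H)"
    using d FGH by (simp add: f hom_iff s)
  then show thesis using that[of F G H] FGH gh by (simp add: s)
qed

text \<open>As \<Sigma> preserves identities, the first homotopy equation becomes a decomposition of
  the identity of \<Sigma>X.\<close>

lemma contractibleE:
  assumes "(u, v, w) \<in> exact T" "u \<in> hom T X Y" "v \<in> hom T Y Z" "w \<in> hom T Z (\<Sigma>\<^sub>o X)"
    and "contractible T (u, v, w)"
  obtains F G H where "F \<in> hom T Y X" "G \<in> hom T Z Y" "H \<in> hom T (\<Sigma>\<^sub>o X) Z"
    "\<one>\<^sub>m (\<Sigma>\<^sub>o X) = (\<Sigma> F \<cdot> \<Sigma> u) \<^bold>+ (w \<cdot> H)" "\<one>\<^sub>m Y = (G \<cdot> v) \<^bold>+ (u \<cdot> F)" "\<one>\<^sub>m Z = (H \<cdot> w) \<^bold>+ (v \<cdot> G)"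
proof -
  have s: "source T u = X" "source T v = Y" "source T w = Z" "\<Sigma> (\<one>\<^sub>m X) = \<one>\<^sub>m (\<Sigma>\<^sub>o X)"
    using assms(2-4) hom_Obj(1)[OF assms(2)] by (simp_all add: hom_iff)
  show thesis
    by (rule nullhomotopicE[OF assms(1,1) assms(5)[unfolded contractible.simps]])
      (rule that; simp only: s)
qed

text \<open>Converse of \<open>nullhomotopicE\<close>: the equation for f may be checked after
  suspension because \<Sigma> is faithful.\<close>

lemma nullhomotopicI:
  assumes "(u, v, w) \<in> exact T" "(u', v', w') \<in> exact T" "f \<in> hom T (source T u) (source T u')"
    and "F \<in> hom T (source T v) (source T u')" "G \<in> hom T (source T w) (source T v')"
    "H \<in> hom T (\<Sigma>\<^sub>o (source T u)) (source T w')"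
    and "\<Sigma> f = (\<Sigma> F \<cdot> \<Sigma> u) \<^bold>+ (w' \<cdot> H)" "g = (G \<cdot> v) \<^bold>+ (u' \<cdot> F)" "h = (H \<cdot> w) \<^bold>+ (v' \<cdot> G)"
  shows "nullhomotopic T (u, v, w) (u', v', w') (f, g, h)"
proof -
  obtain X Y Z where t: "X \<in> Obj T" "Y \<in> Obj T" "Z \<in> Obj T"
    "u \<in> hom T X Y" "v \<in> hom T Y Z" "w \<in> hom T Z (\<Sigma>\<^sub>o X)" using assms(1) by (rule exactE)
  obtain X' Y' Z' where t': "X' \<in> Obj T" "Y' \<in> Obj T" "Z' \<in> Obj T"
    "u' \<in> hom T X' Y'" "v' \<in> hom T Y' Z'" "w' \<in> hom T Z' (\<Sigma>\<^sub>o X')" using assms(2) by (rule exactE)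
  note s = t[unfolded hom_iff] t'[unfolded hom_iff]
  note FGH = assms(3-6)[unfolded hom_iff]
  have d: "desusp T X X' (w' \<cdot> H) \<in> hom T X X'" "\<Sigma> (desusp T X X' (w' \<cdot> H)) = w' \<cdot> H"
    using susp_desusp[OF t(1) t'(1), of "w' \<cdot> H"] FGH by (simp_all add: s hom_iff)
  have "f = (F \<cdot> u) \<^bold>+ desusp T X X' (w' \<cdot> H)"
    by (rule susp_faithful[of _ X X']) (use d FGH in \<open>simp_all add: assms(7) hom_iff s\<close>)
  then show ?thesis
    using assms(4-6,8,9) by (simp only: nullhomotopic.simps s) (intro bexI[of _ F] bexI[of _ G] bexI[of _ H], auto)
qed

text \<open>A contraction decomposes identities, for example 1 = G v + u F on Y. Composing with the
  map on the left if the source is contractible, and on the right if the target is, gives the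
  homotopy; the commuting squares bring each term into the required shape.\<close>

lemma contractible_nullhomotopic:
  assumes E: "(u, v, w) \<in> exact T" and E': "(u', v', w') \<in> exact T"
    and m: "triangle_map T (u, v, w) (u', v', w') (f, g, h)"
    and C: "contractible T (u, v, w) \<or> contractible T (u', v', w')"
  shows "nullhomotopic T (u, v, w) (u', v', w') (f, g, h)"
proof -
  obtain X Y Z where t: "X \<in> Obj T" "Y \<in> Obj T" "Z \<in> Obj T"
    "u \<in> hom T X Y" "v \<in> hom T Y Z" "w \<in> hom T Z (\<Sigma>\<^sub>o X)" using E by (rule exactE)
  obtain X' Y' Z' where t': "X' \<in> Obj T" "Y' \<in> Obj T" "Z' \<in> Obj T"
    "u' \<in> hom T X' Y'" "v' \<in> hom T Y' Z'" "w' \<in> hom T Z' (\<Sigma>\<^sub>o X')" using E' by (rule exactE)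
  note s = t[unfolded hom_iff] t'[unfolded hom_iff]
  have fgh: "f \<in> hom T X X'" "g \<in> hom T Y Y'" "h \<in> hom T Z Z'"
    and sq: "g \<cdot> u = u' \<cdot> f" "h \<cdot> v = v' \<cdot> g" "\<Sigma> f \<cdot> w = w' \<cdot> h"
    using m by (simp_all add: s)
  note s = s fgh[unfolded hom_iff]
  from C show ?thesis
  proof
    assume c: "contractible T (u, v, w)"
    obtain F G H where FGH: "F \<in> hom T Y X" "G \<in> hom T Z Y" "H \<in> hom T (\<Sigma>\<^sub>o X) Z"
      and eq: "\<one>\<^sub>m (\<Sigma>\<^sub>o X) = (\<Sigma> F \<cdot> \<Sigma> u) \<^bold>+ (w \<cdot> H)" "\<one>\<^sub>m Y = (G \<cdot> v) \<^bold>+ (u \<cdot> F)" "\<one>\<^sub>m Z = (H \<cdot> w) \<^bold>+ (v \<cdot> G)"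
      by (rule contractibleE[OF E t(4-6) c])
    note s = s FGH[unfolded hom_iff]
    show ?thesis
    proof (rule nullhomotopicI[OF E E', of f "f \<cdot> F" "g \<cdot> G" "h \<cdot> H"])
      show "\<Sigma> f = (\<Sigma> (f \<cdot> F) \<cdot> \<Sigma> u) \<^bold>+ (w' \<cdot> (h \<cdot> H))"
        using arg_cong[OF eq(1), of "\<lambda>x. \<Sigma> f \<cdot> x"] by (simp add: s cmp_reassoc[OF sq(3)])
      show "g = ((g \<cdot> G) \<cdot> v) \<^bold>+ (u' \<cdot> (f \<cdot> F))"
        using arg_cong[OF eq(2), of "\<lambda>x. g \<cdot> x"] by (simp add: s cmp_reassoc[OF sq(1)])
      show "h = ((h \<cdot> H) \<cdot> w) \<^bold>+ (v' \<cdot> (g \<cdot> G))"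
        using arg_cong[OF eq(3), of "\<lambda>x. h \<cdot> x"] by (simp add: s cmp_reassoc[OF sq(2)])
    qed (simp_all add: s hom_iff)
  next
    assume c: "contractible T (u', v', w')"
    obtain F G H where FGH: "F \<in> hom T Y' X'" "G \<in> hom T Z' Y'" "H \<in> hom T (\<Sigma>\<^sub>o X') Z'"
      and eq: "\<one>\<^sub>m (\<Sigma>\<^sub>o X') = (\<Sigma> F \<cdot> \<Sigma> u') \<^bold>+ (w' \<cdot> H)" "\<one>\<^sub>m Y' = (G \<cdot> v') \<^bold>+ (u' \<cdot> F)"
        "\<one>\<^sub>m Z' = (H \<cdot> w') \<^bold>+ (v' \<cdot> G)"
      by (rule contractibleE[OF E' t'(4-6) c])
    note s = s FGH[unfolded hom_iff]
    \<comment> \<open>The equation for f is proved after suspension, so the first square has to be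
      suspended too.\<close>
    have sq1: "\<Sigma> g \<cdot> \<Sigma> u = \<Sigma> u' \<cdot> \<Sigma> f" using arg_cong[OF sq(1), of "susp T"] by (simp add: s)
    show ?thesis
    proof (rule nullhomotopicI[OF E E', of f "F \<cdot> g" "G \<cdot> h" "H \<cdot> \<Sigma> f"])
      show "\<Sigma> f = (\<Sigma> (F \<cdot> g) \<cdot> \<Sigma> u) \<^bold>+ (w' \<cdot> (H \<cdot> \<Sigma> f))"
        using arg_cong[OF eq(1), of "\<lambda>x. x \<cdot> \<Sigma> f"] by (simp add: s sq1)
      show "g = ((G \<cdot> h) \<cdot> v) \<^bold>+ (u' \<cdot> (F \<cdot> g))"
        using arg_cong[OF eq(2), of "\<lambda>x. x \<cdot> g"] by (simp add: s sq)
      show "h = ((H \<cdot> \<Sigma> f) \<cdot> w) \<^bold>+ (v' \<cdot> (G \<cdot> h))"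
        using arg_cong[OF eq(3), of "\<lambda>x. x \<cdot> h"] by (simp add: s sq)
    qed (simp_all add: s hom_iff)
  qed
qed

text \<open>As with matrices, the canonical map is used through its composites with the injections.
  These are the suspended injections that \<open>biproduct_susp\<close> provides for \<Sigma>(A
  \<oplus> B).\<close>

lemma susp_bip:
  assumes "A \<in> Obj T" "B \<in> Obj T"
  shows "susp_bip T A B \<in> hom T (bip_obj T (\<Sigma>\<^sub>o A) (\<Sigma>\<^sub>o B)) (\<Sigma>\<^sub>o (bip_obj T A B))"
    "susp_bip T A B \<cdot> inj1 T (\<Sigma>\<^sub>o A) (\<Sigma>\<^sub>o B) = \<Sigma> (inj1 T A B)"
    "susp_bip T A B \<cdot> inj2 T (\<Sigma>\<^sub>o A) (\<Sigma>\<^sub>o B) = \<Sigma> (inj2 T A B)"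
proof -
  note D = biproductD[OF bip[OF assms]]
    and D' = biproductD[OF bip[OF susp_Obj[OF assms(1)] susp_Obj[OF assms(2)]]]
  note t = D(1-7)[unfolded hom_iff] D'(1-7)[unfolded hom_iff]
  show "susp_bip T A B \<in> hom T (bip_obj T (\<Sigma>\<^sub>o A) (\<Sigma>\<^sub>o B)) (\<Sigma>\<^sub>o (bip_obj T A B))"
    "susp_bip T A B \<cdot> inj1 T (\<Sigma>\<^sub>o A) (\<Sigma>\<^sub>o B) = \<Sigma> (inj1 T A B)"
    "susp_bip T A B \<cdot> inj2 T (\<Sigma>\<^sub>o A) (\<Sigma>\<^sub>o B) = \<Sigma> (inj2 T A B)"
    by (simp_all add: susp_bip_def hom_iff t D'(8-11))
qed

text \<open>
  In the sheared biproduct structures, the mapping cone is the direct sum of the target triangle and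
  the rotated source triangle with all signs changed.
\<close>

lemma nullhomotopic_good:
  assumes E: "(u, v, w) \<in> exact T" and E': "(u', v', w') \<in> exact T"
    and N: "nullhomotopic T (u, v, w) (u', v', w') (f, g, h)"
    and m: "triangle_map T (u, v, w) (u', v', w') (f, g, h)"
  shows "good T (u, v, w) (u', v', w') (f, g, h)"
proof -
  obtain X Y Z where t: "X \<in> Obj T" "Y \<in> Obj T" "Z \<in> Obj T"
    "u \<in> hom T X Y" "v \<in> hom T Y Z" "w \<in> hom T Z (\<Sigma>\<^sub>o X)" using E by (rule exactE)
  obtain X' Y' Z' where t': "X' \<in> Obj T" "Y' \<in> Obj T" "Z' \<in> Obj T"
    "u' \<in> hom T X' Y'" "v' \<in> hom T Y' Z'" "w' \<in> hom T Z' (\<Sigma>\<^sub>o X')" using E' by (rule exactE)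
  note s = t[unfolded hom_iff] t'[unfolded hom_iff]
  have fgh: "f \<in> hom T X X'" "g \<in> hom T Y Y'" "h \<in> hom T Z Z'"
    using m by (simp_all add: s)
  obtain F G H where FGH: "F \<in> hom T Y X'" "G \<in> hom T Z Y'" "H \<in> hom T (\<Sigma>\<^sub>o X) Z'"
    and eq: "\<Sigma> f = (\<Sigma> F \<cdot> \<Sigma> u) \<^bold>+ (w' \<cdot> H)" "g = (G \<cdot> v) \<^bold>+ (u' \<cdot> F)" "h = (H \<cdot> w) \<^bold>+ (v' \<cdot> G)"
    using nullhomotopicE[OF E E' N] by (auto simp: s)
  have SX: "\<Sigma>\<^sub>o X \<in> Obj T" "\<Sigma>\<^sub>o X' \<in> Obj T" "\<Sigma>\<^sub>o Y \<in> Obj T" using s by simp_all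
  define a where "a = matrix_arr T X' Y Y' Z u' g (\<zero>\<^sub>m X' Z) (neg_arr T v)"
  define b where "b = matrix_arr T Y' Z Z' (\<Sigma>\<^sub>o X) v' h (\<zero>\<^sub>m Y' (\<Sigma>\<^sub>o X)) (neg_arr T w)"
  define c0 where "c0 = matrix_arr T Z' (\<Sigma>\<^sub>o X) (\<Sigma>\<^sub>o X') (\<Sigma>\<^sub>o Y) w' (\<Sigma> f) (\<zero>\<^sub>m Z' (\<Sigma>\<^sub>o Y)) (neg_arr T (\<Sigma> u))"
  define c where "c = susp_bip T X' Y \<cdot> c0"
  have cone: "mapping_cone T (u, v, w) (u', v', w') (f, g, h) = (a, b, c)"
    by (simp add: s Let_def a_def b_def c_def c0_def)
  note B1 = bip[OF t'(1) t(2)] and B2 = bip[OF t'(2) t(3)] and B3 = bip[OF t'(3) SX(1)]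
    and B4 = bip[OF SX(2,3)]
  note D1 = biproductD[OF B1] and D2 = biproductD[OF B2] and D3 = biproductD[OF B3]
    and D4 = biproductD[OF B4]
  note s = s fgh[unfolded hom_iff] FGH[unfolded hom_iff] D1(3-5)[unfolded hom_iff] D2(3-5)[unfolded hom_iff]
    D3(3-5)[unfolded hom_iff] D4(3-5)[unfolded hom_iff]
  have a: "a \<in> hom T (bip_obj T X' Y) (bip_obj T Y' Z)"
    "a \<cdot> inj1 T X' Y = inj1 T Y' Z \<cdot> u'"
    "a \<cdot> inj2 T X' Y = (inj1 T Y' Z \<cdot> g) \<^bold>+ neg_arr T (inj2 T Y' Z \<cdot> v)"
    using matrix_arr[of u' X' Y' g Y "\<zero>\<^sub>m X' Z" Z "neg_arr T v"]
    by (simp_all add: s hom_iff a_def)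
  have b: "b \<in> hom T (bip_obj T Y' Z) (bip_obj T Z' (\<Sigma>\<^sub>o X))"
    "b \<cdot> inj1 T Y' Z = inj1 T Z' (\<Sigma>\<^sub>o X) \<cdot> v'"
    "b \<cdot> inj2 T Y' Z = (inj1 T Z' (\<Sigma>\<^sub>o X) \<cdot> h) \<^bold>+ neg_arr T (inj2 T Z' (\<Sigma>\<^sub>o X) \<cdot> w)"
    using matrix_arr[of v' Y' Z' h Z "\<zero>\<^sub>m Y' (\<Sigma>\<^sub>o X)" "\<Sigma>\<^sub>o X" "neg_arr T w"]
    by (simp_all add: s hom_iff b_def)
  have c0: "c0 \<in> hom T (bip_obj T Z' (\<Sigma>\<^sub>o X)) (bip_obj T (\<Sigma>\<^sub>o X') (\<Sigma>\<^sub>o Y))"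
    "c0 \<cdot> inj1 T Z' (\<Sigma>\<^sub>o X) = inj1 T (\<Sigma>\<^sub>o X') (\<Sigma>\<^sub>o Y) \<cdot> w'"
    "c0 \<cdot> inj2 T Z' (\<Sigma>\<^sub>o X) =
      (inj1 T (\<Sigma>\<^sub>o X') (\<Sigma>\<^sub>o Y) \<cdot> \<Sigma> f) \<^bold>+ neg_arr T (inj2 T (\<Sigma>\<^sub>o X') (\<Sigma>\<^sub>o Y) \<cdot> \<Sigma> u)"
    using matrix_arr[of w' Z' "\<Sigma>\<^sub>o X'" "\<Sigma> f" "\<Sigma>\<^sub>o X" "\<zero>\<^sub>m Z' (\<Sigma>\<^sub>o Y)" "\<Sigma>\<^sub>o Y" "neg_arr T (\<Sigma> u)"]
    by (simp_all add: s hom_iff c0_def)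
  note sb = susp_bip[OF t'(1) t(2)]
  note s = s a(1)[unfolded hom_iff] b(1)[unfolded hom_iff] c0(1)[unfolded hom_iff] sb(1)[unfolded hom_iff]
  have c: "c \<in> hom T (bip_obj T Z' (\<Sigma>\<^sub>o X)) (\<Sigma>\<^sub>o (bip_obj T X' Y))"
    "c \<cdot> inj1 T Z' (\<Sigma>\<^sub>o X) = \<Sigma> (inj1 T X' Y) \<cdot> w'"
    "c \<cdot> inj2 T Z' (\<Sigma>\<^sub>o X) = (\<Sigma> (inj1 T X' Y) \<cdot> \<Sigma> f) \<^bold>+ neg_arr T (\<Sigma> (inj2 T X' Y) \<cdot> \<Sigma> u)"
    by (simp_all add: c_def hom_iff s c0(2,3) sb(2,3)[THEN cmp_reassoc])
  note s = s c(1)[unfolded hom_iff]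
  note abc = a(2,3) b(2,3) c(2,3)
  show ?thesis
    unfolding good_def cone
  proof (rule exact_biproduct[OF E' exact_rotate_neg[OF E]])
    show "biproduct T (source T u') (source T (neg_arr T v)) (bip_obj T X' Y, inj1 T X' Y,
      inj2 T X' Y \<^bold>+ neg_arr T (inj1 T X' Y \<cdot> F), proj1 T X' Y \<^bold>+ (F \<cdot> proj2 T X' Y), proj2 T X' Y)"
      using biproduct_shear[OF B1 FGH(1)] by (simp add: s)
    show "biproduct T (source T v') (source T (neg_arr T w)) (bip_obj T Y' Z, inj1 T Y' Z,
      inj2 T Y' Z \<^bold>+ neg_arr T (inj1 T Y' Z \<cdot> G), proj1 T Y' Z \<^bold>+ (G \<cdot> proj2 T Y' Z), proj2 T Y' Z)"
      using biproduct_shear[OF B2 FGH(2)] by (simp add: s)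
    show "biproduct T (source T w') (source T (neg_arr T (\<Sigma> u))) (bip_obj T Z' (\<Sigma>\<^sub>o X), inj1 T Z' (\<Sigma>\<^sub>o X),
      inj2 T Z' (\<Sigma>\<^sub>o X) \<^bold>+ neg_arr T (inj1 T Z' (\<Sigma>\<^sub>o X) \<cdot> H),
      proj1 T Z' (\<Sigma>\<^sub>o X) \<^bold>+ (H \<cdot> proj2 T Z' (\<Sigma>\<^sub>o X)), proj2 T Z' (\<Sigma>\<^sub>o X))"
      using biproduct_shear[OF B3 FGH(3)] by (simp add: s)
    show "candidate_triangle T (a, b, c)" by (simp add: s)
    show "triangle_map T (u', v', w') (a, b, c) (inj1 T X' Y, inj1 T Y' Z, inj1 T Z' (\<Sigma>\<^sub>o X))"
      by (simp add: hom_iff s abc)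
    \<comment> \<open>With injections i1, i2 into X' \<oplus> Y and j1, j2 into Y' \<oplus> Z, the
      cone sends i2 - i1 F to j1 (g - u' F) - j2 v = (j2 - j1 G)(-v), by g = G v + u' F. The other
      two squares are the same computation for h and \<Sigma>f.\<close>
    show "triangle_map T (neg_arr T v, neg_arr T w, neg_arr T (\<Sigma> u)) (a, b, c)
      (inj2 T X' Y \<^bold>+ neg_arr T (inj1 T X' Y \<cdot> F), inj2 T Y' Z \<^bold>+ neg_arr T (inj1 T Y' Z \<cdot> G),
       inj2 T Z' (\<Sigma>\<^sub>o X) \<^bold>+ neg_arr T (inj1 T Z' (\<Sigma>\<^sub>o X) \<cdot> H))"
      by (simp add: hom_iff s abc abc[THEN cmp_reassoc] eq plus_ac plus_plus_neg)
  qed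
qed

section \<open>Modifying octahedra\<close>

text \<open>The automorphism \<open>1 + c' k c''\<close> of the cone of the composite moves one octahedron to another.\<close>

lemma octahedron_modify:
  assumes A: "(a, a', a'') \<in> exact T" and B: "(b, b', b'') \<in> exact T" and C: "(c, c', c'') \<in> exact T"
    and "octahedron T (a, a', a'') (b, b', b'') (c, c', c'') (\<alpha>, \<beta>, \<gamma>)"
    and "source T c = source T a" "source T b = target T a" "target T c = target T b"
    and k: "k \<in> hom T (\<Sigma>\<^sub>o (source T c)) (target T c)"
  shows "octahedron T (a, a', a'') (b, b', b'') (c, c', c'')
    (\<alpha> \<^bold>+ (c' \<cdot> (k \<cdot> a'')), \<beta> \<^bold>+ neg_arr T (b' \<cdot> (k \<cdot> c'')), \<gamma>)"
proof -
  obtain X Y Ca where tA: "X \<in> Obj T" "Y \<in> Obj T" "Ca \<in> Obj T"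
    "a \<in> hom T X Y" "a' \<in> hom T Y Ca" "a'' \<in> hom T Ca (\<Sigma>\<^sub>o X)" using A by (rule exactE)
  obtain Y0 Z Cb where tB: "Y0 \<in> Obj T" "Z \<in> Obj T" "Cb \<in> Obj T"
    "b \<in> hom T Y0 Z" "b' \<in> hom T Z Cb" "b'' \<in> hom T Cb (\<Sigma>\<^sub>o Y0)" using B by (rule exactE)
  obtain X1 Z1 Cc where tC: "X1 \<in> Obj T" "Z1 \<in> Obj T" "Cc \<in> Obj T"
    "c \<in> hom T X1 Z1" "c' \<in> hom T Z1 Cc" "c'' \<in> hom T Cc (\<Sigma>\<^sub>o X1)" using C by (rule exactE)
  have [simp]: "X1 = X" "Y0 = Y" "Z1 = Z" using assms(5-7) tA tB tC by (simp_all add: hom_iff)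
  have Cs: "target T a' = Ca" "target T b' = Cb" "target T c' = Cc"
    using tA tB tC by (simp_all add: hom_iff)
  have oct: "\<alpha> \<in> hom T Ca Cc" "\<beta> \<in> hom T Cc Cb" "\<gamma> \<in> hom T Cb (\<Sigma>\<^sub>o Ca)" "(\<alpha>, \<beta>, \<gamma>) \<in> exact T"
    and eq: "\<alpha> \<cdot> a' = c' \<cdot> b" "c'' \<cdot> \<alpha> = a''" "\<beta> \<cdot> c' = b'" "\<gamma> = \<Sigma> a' \<cdot> b''" "b'' \<cdot> \<beta> = \<Sigma> a \<cdot> c''"
    using assms(4) unfolding octahedron.simps Cs by blast+
  have k': "k \<in> hom T (\<Sigma>\<^sub>o X) Z" using k tC by (simp add: hom_iff)
  note s = tA[unfolded hom_iff] tB[unfolded hom_iff] tC[unfolded hom_iff] oct(1,2)[unfolded hom_iff]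
    k'[unfolded hom_iff]
  have z: "a'' \<cdot> a' = \<zero>\<^sub>m Y (\<Sigma>\<^sub>o X)" "c'' \<cdot> c' = \<zero>\<^sub>m Z (\<Sigma>\<^sub>o X)" "b'' \<cdot> b' = \<zero>\<^sub>m Z (\<Sigma>\<^sub>o Y)"
    using exact_cmp_zero[OF exact_rotate'[OF A]] exact_cmp_zero[OF exact_rotate'[OF B]]
      exact_cmp_zero[OF exact_rotate'[OF C]] tA tB tC by simp_all
  note r = z z[THEN cmp_reassoc] eq(1,2,3,5) eq(1,2,3,5)[THEN cmp_reassoc]
  \<comment> \<open>Since c'' c' = 0, the term c' k c'' squares to zero, which makes these two
    arrows inverse to each other.\<close>
  define \<tau> \<tau>' where "\<tau> = \<one>\<^sub>m Cc \<^bold>+ (c' \<cdot> (k \<cdot> c''))" and "\<tau>' = \<one>\<^sub>m Cc \<^bold>+ neg_arr T (c' \<cdot> (k \<cdot> c''))"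
  have i: "iso_arr T \<tau>"
    by (rule iso_arrI[of _ Cc Cc \<tau>']) (simp_all add: \<tau>_def \<tau>'_def hom_iff s r plus_assoc)
  \<comment> \<open>By c'' \<alpha> = a'' and \<beta> c' = b', the new arrows are \<tau> \<alpha>
    and \<beta> \<tau>'. The second is stated after multiplication by \<tau>, as the map of
    triangles requires.\<close>
  have \<tau>: "\<tau> \<in> hom T Cc Cc" "\<tau> \<cdot> \<alpha> = \<alpha> \<^bold>+ (c' \<cdot> (k \<cdot> a''))"
    "(\<beta> \<^bold>+ neg_arr T (b' \<cdot> (k \<cdot> c''))) \<cdot> \<tau> = \<beta>"
    by (simp_all add: \<tau>_def hom_iff s r plus_assoc)
  have g: "\<gamma> \<in> Arr T" "source T \<gamma> = Cb" "target T \<gamma> = \<Sigma>\<^sub>o Ca" using oct(3) by (simp_all add: hom_iff)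
  have "(\<alpha> \<^bold>+ (c' \<cdot> (k \<cdot> a'')), \<beta> \<^bold>+ neg_arr T (b' \<cdot> (k \<cdot> c'')), \<gamma>) \<in> exact T"
  proof (rule exact_iso[OF oct(4), of _ "\<one>\<^sub>m Ca" \<tau> "\<one>\<^sub>m Cb"])
    show "triangle_map T (\<alpha>, \<beta>, \<gamma>) (\<alpha> \<^bold>+ (c' \<cdot> (k \<cdot> a'')), \<beta> \<^bold>+ neg_arr T (b' \<cdot> (k \<cdot> c'')), \<gamma>)
       (\<one>\<^sub>m Ca, \<tau>, \<one>\<^sub>m Cb)"
      using \<tau> by (simp add: hom_iff s g del: cmp_plus)
  qed (simp_all add: i iso_arr_ident s g)
  moreover have "\<alpha> \<^bold>+ (c' \<cdot> (k \<cdot> a'')) \<in> hom T Ca Cc" "\<beta> \<^bold>+ neg_arr T (b' \<cdot> (k \<cdot> c'')) \<in> hom T Cc Cb"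
    by (simp_all add: hom_iff s)
  \<comment> \<open>The octahedral identities survive because each correction term contains a'' a',
    c'' c' or b'' b', which vanish.\<close>
  moreover have "(\<alpha> \<^bold>+ (c' \<cdot> (k \<cdot> a''))) \<cdot> a' = c' \<cdot> b" "c'' \<cdot> (\<alpha> \<^bold>+ (c' \<cdot> (k \<cdot> a''))) = a''"
    "(\<beta> \<^bold>+ neg_arr T (b' \<cdot> (k \<cdot> c''))) \<cdot> c' = b'"
    "b'' \<cdot> (\<beta> \<^bold>+ neg_arr T (b' \<cdot> (k \<cdot> c''))) = \<Sigma> a \<cdot> c''"
    by (simp_all add: s r)
  ultimately show ?thesis using oct(3) eq(4) by (simp add: s)
qed

text \<open>If the source is contractible, then d = d (H w + v G) = d H w, and d H lifts through v'
  because w' d H = 0. If the target is, then d = (H w' + v' G) d = v' G d, and G d factors through w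
  because G d v = 0.\<close>

lemma contractible_factor:
  assumes E: "(u, v, w) \<in> exact T" and E': "(u', v', w') \<in> exact T"
    and d: "d \<in> hom T (source T w) (source T w')"
    and dv: "d \<cdot> v = \<zero>\<^sub>m (source T v) (source T w')" and wd: "w' \<cdot> d = \<zero>\<^sub>m (source T w) (target T w')"
    and C: "contractible T (u, v, w) \<or> contractible T (u', v', w')"
  shows "\<exists>k \<in> hom T (\<Sigma>\<^sub>o (source T u)) (target T u'). d = v' \<cdot> (k \<cdot> w)"
proof -
  obtain X Y Z where t: "X \<in> Obj T" "Y \<in> Obj T" "Z \<in> Obj T"
    "u \<in> hom T X Y" "v \<in> hom T Y Z" "w \<in> hom T Z (\<Sigma>\<^sub>o X)" using E by (rule exactE)
  obtain X' Y' Z' where t': "X' \<in> Obj T" "Y' \<in> Obj T" "Z' \<in> Obj T"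
    "u' \<in> hom T X' Y'" "v' \<in> hom T Y' Z'" "w' \<in> hom T Z' (\<Sigma>\<^sub>o X')" using E' by (rule exactE)
  note s = t[unfolded hom_iff] t'[unfolded hom_iff]
  have d: "d \<in> hom T Z Z'" and dv: "d \<cdot> v = \<zero>\<^sub>m Y Z'" and wd: "w' \<cdot> d = \<zero>\<^sub>m Z (\<Sigma>\<^sub>o X')"
    using d dv wd by (simp_all add: s)
  note s = s d[unfolded hom_iff]
  from C have "\<exists>k \<in> hom T (\<Sigma>\<^sub>o X) Y'. d = v' \<cdot> (k \<cdot> w)"
  proof
    assume c: "contractible T (u, v, w)"
    obtain G H where GH: "G \<in> hom T Z Y" "H \<in> hom T (\<Sigma>\<^sub>o X) Z"
      and eq: "\<one>\<^sub>m Z = (H \<cdot> w) \<^bold>+ (v \<cdot> G)"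
      by (rule contractibleE[OF E t(4-6) c])
    note s = s GH[unfolded hom_iff]
    have dH: "d = d \<cdot> (H \<cdot> w)"
      using arg_cong[OF eq, of "\<lambda>x. d \<cdot> x"] by (simp add: s cmp_reassoc[OF dv])
    obtain k where "k \<in> hom T (\<Sigma>\<^sub>o X) Y'" "d \<cdot> H = v' \<cdot> k"
      using exact_weak_kernel[OF exact_rotate'[OF E'] t'(5,6), of "d \<cdot> H" "\<Sigma>\<^sub>o X"]
      by (auto simp: hom_iff s cmp_reassoc[OF wd])
    then show ?thesis
      using dH cmp_reassoc[of d H "v' \<cdot> k" w] by (intro bexI[of _ k]) (simp_all add: hom_iff s)
  next
    assume c: "contractible T (u', v', w')"
    obtain G H where GH: "G \<in> hom T Z' Y'" "H \<in> hom T (\<Sigma>\<^sub>o X') Z'"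
      and eq: "\<one>\<^sub>m Z' = (H \<cdot> w') \<^bold>+ (v' \<cdot> G)"
      by (rule contractibleE[OF E' t'(4-6) c])
    note s = s GH[unfolded hom_iff]
    have Gd: "d = v' \<cdot> (G \<cdot> d)"
      using arg_cong[OF eq, of "\<lambda>x. x \<cdot> d"] by (simp add: s wd)
    obtain k where "k \<in> hom T (\<Sigma>\<^sub>o X) Y'" "G \<cdot> d = k \<cdot> w"
      using exact_weak_cokernel[OF exact_rotate'[OF E] t(5,6), of "G \<cdot> d" Y']
      by (auto simp: hom_iff s dv)
    then show ?thesis using Gd by auto
  qed
  then show ?thesis by (simp add: s)
qed

section \<open>Verdier goodness\<close>

lemma contractible_Verdier_good:
  assumes E: "(u, v, w) \<in> exact T" and E': "(u', v', w') \<in> exact T"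
    and m: "triangle_map T (u, v, w) (u', v', w') (f, g, h)"
    and C: "contractible T (u, v, w) \<or> contractible T (u', v', w')"
  shows "Verdier_good T (u, v, w) (u', v', w') (f, g, h)"
  unfolding Verdier_good.simps
proof (intro allI impI, elim conjE)
  fix f' f'' g' g'' vA wA
  assume Ef: "(f, f', f'') \<in> exact T" and Eg: "(g, g', g'') \<in> exact T" and EA: "(g \<cdot> u, vA, wA) \<in> exact T"
  obtain X Y Z where t: "X \<in> Obj T" "Y \<in> Obj T" "Z \<in> Obj T"
    "u \<in> hom T X Y" "v \<in> hom T Y Z" "w \<in> hom T Z (\<Sigma>\<^sub>o X)" using E by (rule exactE)
  obtain X' Y' Z' where t': "X' \<in> Obj T" "Y' \<in> Obj T" "Z' \<in> Obj T"
    "u' \<in> hom T X' Y'" "v' \<in> hom T Y' Z'" "w' \<in> hom T Z' (\<Sigma>\<^sub>o X')" using E' by (rule exactE)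
  note s = t[unfolded hom_iff] t'[unfolded hom_iff]
  have fgh: "f \<in> hom T X X'" "g \<in> hom T Y Y'" "h \<in> hom T Z Z'"
    and sq: "g \<cdot> u = u' \<cdot> f" "h \<cdot> v = v' \<cdot> g" "\<Sigma> f \<cdot> w = w' \<cdot> h"
    using m by (simp_all add: s)
  note s = s fgh[unfolded hom_iff]
  have gu: "g \<cdot> u \<in> hom T X Y'" by (simp add: hom_iff s)
  obtain A where tA: "A \<in> Obj T" "vA \<in> hom T Y' A" "wA \<in> hom T A (\<Sigma>\<^sub>o X)"
    using EA by (rule exactE) (use gu in \<open>auto simp: hom_iff\<close>)
  \<comment> \<open>Commutativity of the first square lets the same triangle serve both
    octahedra.\<close>
  have EA': "(u' \<cdot> f, vA, wA) \<in> exact T" using EA sq by simp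
  \<comment> \<open>The octahedral axiom gives some pair of octahedra. Then \<beta>2 \<alpha>1
    completes (f, g) to a map of triangles, but it can differ from h.\<close>
  obtain \<alpha>1 \<beta>1 \<gamma>1 where O1: "octahedron T (u, v, w) (g, g', g'') (g \<cdot> u, vA, wA) (\<alpha>1, \<beta>1, \<gamma>1)"
    using exact_octahedron[OF E Eg _ EA] by (auto simp: s)
  obtain \<alpha>2 \<beta>2 \<gamma>2 where O2: "octahedron T (f, f', f'') (u', v', w') (u' \<cdot> f, vA, wA) (\<alpha>2, \<beta>2, \<gamma>2)"
    using exact_octahedron[OF Ef E' _ EA'] by (auto simp: s)
  note s = s tA[unfolded hom_iff]
  have \<alpha>: "\<alpha>1 \<in> hom T Z A" "\<alpha>1 \<cdot> v = vA \<cdot> g" "wA \<cdot> \<alpha>1 = w" using O1 by (simp_all add: s)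
  have \<beta>: "\<beta>2 \<in> hom T A Z'" "\<beta>2 \<cdot> vA = v'" "w' \<cdot> \<beta>2 = \<Sigma> f \<cdot> wA" using O2 by (simp_all add: s)
  note s = s \<alpha>(1)[unfolded hom_iff] \<beta>(1)[unfolded hom_iff]
  \<comment> \<open>Being the difference of two completions of (f, g), d satisfies d v = 0 and w' d
    = 0.\<close>
  define d where "d = h \<^bold>+ neg_arr T (\<beta>2 \<cdot> \<alpha>1)"
  have d: "d \<in> hom T Z Z'" by (simp add: d_def hom_iff s)
  have dv: "d \<cdot> v = \<zero>\<^sub>m Y Z'" by (simp add: d_def s sq \<alpha> \<beta>(2)[THEN cmp_reassoc])
  have wd: "w' \<cdot> d = \<zero>\<^sub>m Z (\<Sigma>\<^sub>o X')"
    using sq(3) by (simp add: d_def s \<alpha> \<beta>(3)[THEN cmp_reassoc])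
  obtain k where k: "k \<in> hom T (\<Sigma>\<^sub>o X) Y'" "d = v' \<cdot> (k \<cdot> w)"
    using contractible_factor[OF E E' _ _ _ C, of d] d dv wd by (auto simp: s)
  \<comment> \<open>Only the first octahedron is moved. Since \<beta>2 vA = v', the new product
    \<beta>2 \<alpha> equals \<beta>2 \<alpha>1 + v' k w, which is \<beta>2 \<alpha>1 + d.\<close>
  define \<alpha> \<beta> where "\<alpha> = \<alpha>1 \<^bold>+ (vA \<cdot> (k \<cdot> w))" and "\<beta> = \<beta>1 \<^bold>+ neg_arr T (g' \<cdot> (k \<cdot> wA))"
  have "octahedron T (u, v, w) (g, g', g'') (g \<cdot> u, vA, wA) (\<alpha>, \<beta>, \<gamma>1)"
    unfolding \<alpha>_def \<beta>_def by (rule octahedron_modify[OF E Eg EA O1]) (use k in \<open>simp_all add: s\<close>)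
  moreover have "h = \<beta>2 \<cdot> \<alpha>"
  proof -
    have "\<beta>2 \<cdot> \<alpha> = (\<beta>2 \<cdot> \<alpha>1) \<^bold>+ d"
      using k by (simp add: \<alpha>_def s hom_iff \<beta>(2)[THEN cmp_reassoc])
    then show ?thesis by (simp add: d_def s plus_left_comm[of _ h])
  qed
  ultimately show "\<exists>\<alpha>\<^sub>1 \<beta>\<^sub>1 \<gamma>\<^sub>1 \<alpha>\<^sub>2 \<beta>\<^sub>2 \<gamma>\<^sub>2.
      octahedron T (u, v, w) (g, g', g'') (g \<cdot> u, vA, wA) (\<alpha>\<^sub>1, \<beta>\<^sub>1, \<gamma>\<^sub>1) \<and>
      octahedron T (f, f', f'') (u', v', w') (u' \<cdot> f, vA, wA) (\<alpha>\<^sub>2, \<beta>\<^sub>2, \<gamma>\<^sub>2) \<and> h = \<beta>\<^sub>2 \<cdot> \<alpha>\<^sub>1"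
    using O2 by blast
qed

end

theorem proposition3p7:
  fixes T :: "('o, 'm) tri_data" (structure)
    and u v w u' v' w' f g h :: 'm
  assumes "triangulated_category T"
    and "(u, v, w) \<in> exact T"
    and "(u', v', w') \<in> exact T"
    and "triangle_map T (u, v, w) (u', v', w') (f, g, h)"
    and "contractible T (u, v, w) \<or> contractible T (u', v', w')"
  shows "good T (u, v, w) (u', v', w') (f, g, h) \<and>
         Verdier_good T (u, v, w) (u', v', w') (f, g, h)"
proof -
  interpret triangulated_category T by (rule assms(1))
  show ?thesis
    using nullhomotopic_good[OF assms(2,3) contractible_nullhomotopic[OF assms(2-5)] assms(4)]
      contractible_Verdier_good[OF assms(2-5)] by blast
qed

end
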